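(* Let $n\ge 2$ and let $K\subset\mathbb{R}^n$ be a hyperangle. Let $S$ be the set of points $A\in\mathbb{R}^n$ for which there is a stationary hyperplane. (i) If $K^*\subset K$, then $S=K^o$. (ii) If an extreme ray of $K$ forms acute angles with the other extreme rays of $K$, then there exists a point $A\in\partial K$ for which there is a unique hyperplane solving the following problem: minimize the $(n-1)$-volume of $K\cap\mathcal{H}$ over all hyperplanes $\mathcal{H}$ through $A$ with $O\notin\mathcal{H}$. In particular, $K^o\subsetneq S$.
   Context: $(\cdot,\cdot)$ is the standard inner product in $\mathbb{R}^n$ and $O$ is the origin. A hyperangle is a closed convex cone in $\mathbb{R}^n$ with vertex $O$ spanned by $n$ linearly independent vectors $e_1,\dots,e_n$, i.e. $K=\{\sum_i t_ie_i:t_i\ge 0\}$; its extreme rays are the rays $\{te_i:t\ge 0\}$. $K^o$ and $\partial K$ are the interior and boundary of $K$. The dual cone is $K^*=\{y:(y,x)\ge 0\ \forall x\in K\}$, and $K^+=(K^* )^o$ is its interior. For $b\ne 0$ let $\mathcal{H}(b)=\{x\in\mathbb{R}^n:(b,x)=1\}$, $K(b)=K\cap\mathcal{H}(b)$, and let $V(b)$ be the $(n-1)$-volume of $K(b)$ (possibly infinite). The hyperplane $\mathcal{H}(b)$ is called admissible if $b\in K^+$ (equivalently, $V(b)$ is finite and $K(b)$ is compact). For a point $A$ with position vector $a=\overrightarrow{OA}$, an admissible hyperplane $\mathcal{H}(b)$ containing $A$ is called a stationary hyperplane for $A$ if $b$ is a stationary point of $V$ under the constraint $(b,a)=1$, i.e.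 the gradient of $V$ at $b$ equals $\lambda a$ for some real $\lambda$. It is a known result that this is equivalent to $\overrightarrow{AH}=n\overrightarrow{AG}$, where $H$ is the orthogonal projection of $O$ on $\mathcal{H}(b)$ and $G$ is the centroid of $K(b)$. *)

theory Defs
  imports "HOL-Analysis.Analysis"
begin

definition hyperangle :: "'a::euclidean_space set \<Rightarrow> 'a set" where
  "hyperangle E = {(\<Sum>v\<in>E. t v *\<^sub>R v) | t. \<forall>v\<in>E. 0 \<le> t v}"

definition dual_cone :: "'a::real_inner set \<Rightarrow> 'a set" where
  "dual_cone K = {y. \<forall>x\<in>K. 0 \<le> y \<bullet> x}"

definition vec_angle :: "'a::real_inner \<Rightarrow> 'a \<Rightarrow> real" where
  "vec_angle x y = arccos ((x \<bullet> y) / (norm x * norm y))"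

definition is_hyperplane :: "'a::real_inner set \<Rightarrow> bool" where
  "is_hyperplane H \<longleftrightarrow> (\<exists>c d. c \<noteq> 0 \<and> H = {x. c \<bullet> x = d})"

definition hplane :: "'a::real_inner \<Rightarrow> 'a set" where
  "hplane b = {x. b \<bullet> x = 1}"

definition orthonormal_basis_of :: "'a::euclidean_space set \<Rightarrow> 'a set \<Rightarrow> bool" where
  "orthonormal_basis_of B U \<longleftrightarrow>
     pairwise orthogonal B \<and> (\<forall>u\<in>B. norm u = 1) \<and> span B = U"

(* Lebesgue measure of the affine subspace H of dimension k, that is, k-dimensional
   Lebesgue measure transported to H by Cartesian coordinates with respect to a point of H
   and an orthonormal basis of the direction space of H (compare lborel_def).
   The choice of point and basis does not matter, since Lebesgue measure is invariant
   under isometries. *)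
definition affine_lborel :: "'a::euclidean_space set \<Rightarrow> 'a measure" where
  "affine_lborel H =
     (let p = (SOME p. p \<in> H);
          B = (SOME B. orthonormal_basis_of B ((\<lambda>x. x - p) ` H))
      in distr (\<Pi>\<^sub>M u\<in>B. lborel) borel (\<lambda>f. p + (\<Sum>u\<in>B. f u *\<^sub>R u)))"

definition section_volume :: "'a::euclidean_space set \<Rightarrow> 'a set \<Rightarrow> ennreal" where
  "section_volume K H = emeasure (affine_lborel H) (K \<inter> H)"

(* Near a point of interior (dual_cone K) the volume is finite, so the passage to real
   values loses nothing in the gradient below. *)
definition stationary_hyperplane :: "'a::euclidean_space set \<Rightarrow> 'a \<Rightarrow> 'a set \<Rightarrow> bool" where
  "stationary_hyperplane K a H \<longleftrightarrow>
     (\<exists>b. H = hplane b \<and> b \<in> interior (dual_cone K) \<and> a \<in> H \<and>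
       (\<exists>l::real. GDERIV (\<lambda>c. enn2real (section_volume K (hplane c))) b :> l *\<^sub>R a))"

definition stationary_points :: "'a::euclidean_space set \<Rightarrow> 'a set" where
  "stationary_points K = {a. \<exists>H. stationary_hyperplane K a H}"

definition minimizing_hyperplane :: "'a::euclidean_space set \<Rightarrow> 'a \<Rightarrow> 'a set \<Rightarrow> bool" where
  "minimizing_hyperplane K a H \<longleftrightarrow>
     is_hyperplane H \<and> a \<in> H \<and> 0 \<notin> H \<and>
     (\<forall>H'. is_hyperplane H' \<and> a \<in> H' \<and> 0 \<notin> H' \<longrightarrow> section_volume K H \<le> section_volume K H')"

end

theory Submission
  imports Defs
begin

text \<open>
  Let \<open>e\<^sub>1, \<dots>, e\<^sub>n\<close> span \<open>K\<close>. Slicing a cone parallel to \<open>\<H>(b)\<close> shows that \<open>V(b)\<close> is \<open>n |b|\<close> times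
  the volume of \<open>{x \<in> K. (b,x) \<le> 1}\<close>, hence \<open>V(b) = C |b| / \<Prod>\<^sub>i (b,e\<^sub>i)\<close> for admissible \<open>b\<close>.
  Thus \<open>A\<close> has a stationary hyperplane iff
  \<open>(n - 1) a = (\<Sum>\<^sub>i e\<^sub>i / (b,e\<^sub>i)) - b / |b|\<^sup>2\<close> for some admissible \<open>b\<close>.
  For \<open>a\<close> in the interior of \<open>K\<close> such a \<open>b\<close> arises by maximizing \<open>1 / V\<close> on the compact set of
  \<open>b \<in> K\<^sup>*\<close> with \<open>(b,a) = 1\<close>. If \<open>K\<^sup>* \<subseteq> K\<close>, then \<open>b\<close> has coordinates \<open>s\<^sub>i > 0\<close> and
  \<open>|b|\<^sup>2 = \<Sum>\<^sub>j s\<^sub>j (b,e\<^sub>j) > s\<^sub>i (b,e\<^sub>i)\<close>, so the coordinates of \<open>a\<close> are positive.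
  If \<open>e\<^sub>1\<close> makes acute angles with the other generators, then \<open>b = e\<^sub>1\<close> is admissible and its
  point \<open>a\<close> lies on the facet opposite to \<open>e\<^sub>1\<close>; there \<open>|b| / (b,e\<^sub>1)\<close> is minimal only in the direction
  of \<open>e\<^sub>1\<close> by Cauchy--Schwarz, while \<open>\<Prod>\<^bsub>j \<ge> 2\<^esub> (b,e\<^sub>j)\<close> is maximal at \<open>e\<^sub>1\<close> by the inequality
  of arithmetic and geometric means.
\<close>

section \<open>Lebesgue measure under affine and linear maps\<close>

text \<open>A product measure is determined by its values on boxes, and on a box the claim is the
  one-dimensional change of variables, one factor \<open>r\<close> for each coordinate. It serves to
  compare parallel slices of a cone.\<close>

lemma PiM_lborel_affine:
  fixes c :: "'b \<Rightarrow> real" and r :: real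
  assumes fin: "finite B" and r: "0 < r"
    and A: "A \<in> sets (\<Pi>\<^sub>M u\<in>B. lborel)"
  shows "emeasure (\<Pi>\<^sub>M u\<in>B. lborel) A = ennreal (r ^ card B) *
    emeasure (\<Pi>\<^sub>M u\<in>B. lborel)
      ((\<lambda>f. \<lambda>u\<in>B. c u + r * f u) -` A \<inter> space (\<Pi>\<^sub>M u\<in>B. lborel))"
proof -
  interpret product_sigma_finite "\<lambda>_::'b. lborel :: real measure" by standard
  let ?M = "\<Pi>\<^sub>M u\<in>B. (lborel :: real measure)"
  let ?T = "\<lambda>f. \<lambda>u\<in>B. c u + r * f u"
  let ?P = "scale_measure (ennreal (r ^ card B)) (distr ?M ?M ?T)"
  have T[measurable]: "?T \<in> ?M \<rightarrow>\<^sub>M ?M" by measurable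
  have "?P = ?M"
  proof (rule PiM_eqI[OF fin])
    show "sets ?P = sets ?M" by simp
    fix A :: "'b \<Rightarrow> real set" assume A: "\<And>i. i \<in> B \<Longrightarrow> A i \<in> sets lborel"
    have pre: "?T -` (Pi\<^sub>E B A) \<inter> space ?M = Pi\<^sub>E B (\<lambda>u. (\<lambda>x. c u + r * x) -` A u)"
      by (auto simp: space_PiM PiE_iff extensional_def)
    have pb: "(\<lambda>x. c u + r * x) -` A u \<in> sets lborel" if "u \<in> B" for u
      using measurable_sets_borel[of "\<lambda>x. c u + r * x" borel "A u"] A[OF that] by simp
    have one: "emeasure lborel (A u) = ennreal r * emeasure lborel ((\<lambda>x. c u + r * x) -` A u)"
      if u: "u \<in> B" for u
    proof -
      have [measurable]: "A u \<in> sets borel" using A[OF u] by simp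
      have "emeasure lborel (A u) = (\<integral>\<^sup>+x. indicator (A u) x \<partial>lborel)" by simp
      also have "\<dots> = ennreal \<bar>r\<bar> * (\<integral>\<^sup>+x. indicator (A u) (c u + r * x) \<partial>lborel)"
        using r by (intro nn_integral_real_affine) auto
      also have "(\<lambda>x. indicator (A u) (c u + r * x) :: ennreal)
                   = indicator ((\<lambda>x. c u + r * x) -` A u)"
        by (auto simp: indicator_def)
      finally show ?thesis using r pb[OF u] by simp
    qed
    have "emeasure ?P (Pi\<^sub>E B A) = ennreal (r ^ card B) *
            (\<Prod>u\<in>B. emeasure lborel ((\<lambda>x. c u + r * x) -` A u))"
      using A fin by (simp add: emeasure_scale_measure emeasure_distr[OF T] sets_PiM_I_finite
          pre emeasure_PiM[OF fin] pb[unfolded sets_lborel])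
    also have "\<dots> = (\<Prod>u\<in>B. emeasure lborel (A u))"
      using r by (simp add: one prod.distrib ennreal_power)
    finally show "emeasure ?P (Pi\<^sub>E B A) = (\<Prod>u\<in>B. emeasure lborel (A u))" .
  qed
  then have "emeasure ?M A = emeasure ?P A" by simp
  also have "\<dots> = ennreal (r ^ card B) * emeasure ?M (?T -` A \<inter> space ?M)"
    using A by (simp add: emeasure_scale_measure emeasure_distr[OF T])
  finally show ?thesis .
qed

text \<open>
  Integrate the indicator of \<open>{(x, y). x \<in> A \<and> x + y \<in> S}\<close> in both orders, where \<open>A = - A\<close> is
  the unit ball. In contrast to the library results on linear images, the consequences below do
  not need a well-order on the index type of \<open>real ^ 'n\<close>.
\<close>

lemma translation_invariant_proportional_lborel:
  fixes N :: "'a::euclidean_space measure"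
  assumes sets_N[measurable_cong]: "sets N = sets borel" and N: "sigma_finite_measure N"
    and inv: "\<And>x S. S \<in> sets borel \<Longrightarrow> emeasure N ((\<lambda>y. x + y) -` S) = emeasure N S"
    and S[measurable]: "S \<in> sets borel"
  shows "emeasure lborel (ball 0 1 :: 'a set) * emeasure N S =
    emeasure N (ball 0 1) * emeasure lborel S"
proof -
  interpret N: sigma_finite_measure N by (rule N)
  interpret pair_sigma_finite lborel N by standard
  let ?A = "ball 0 1 :: 'a set"
  have [measurable]: "?A \<in> sets borel" by simp
  have pre: "(\<lambda>y. x + y) -` T \<in> sets N" if "T \<in> sets borel" for x T
    using measurable_sets_borel[of "\<lambda>y. x + y" borel T] that by (simp add: sets_N)
  have "emeasure lborel ?A * emeasure N S =
      (\<integral>\<^sup>+x. (\<integral>\<^sup>+y. indicator ?A x * indicator S (x + y) \<partial>N) \<partial>lborel)"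
  proof -
    have "(\<integral>\<^sup>+y. indicator ?A x * indicator S (x + y) \<partial>N) = indicator ?A x * emeasure N S" for x
    proof -
      have "(\<integral>\<^sup>+y. indicator S (x + y) \<partial>N) = (\<integral>\<^sup>+y. indicator ((\<lambda>y. x + y) -` S) y \<partial>N)"
        by (simp add: indicator_def)
      also have "\<dots> = emeasure N S" using inv[OF S] pre[OF S] by simp
      finally show ?thesis by (subst nn_integral_cmult) auto
    qed
    then show ?thesis by (simp add: nn_integral_multc)
  qed
  also have "\<dots> = (\<integral>\<^sup>+y. (\<integral>\<^sup>+x. indicator ?A x * indicator S (x + y) \<partial>lborel) \<partial>N)"
    by (rule Fubini'[symmetric]) measurable
  also have "\<dots> = (\<integral>\<^sup>+y. (\<integral>\<^sup>+x. indicator ?A (x - y) * indicator S x \<partial>lborel) \<partial>N)"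
  proof (rule nn_integral_cong)
    fix y
    have "(\<integral>\<^sup>+x. indicator ?A x * indicator S (x + y) \<partial>lborel) =
       (\<integral>\<^sup>+x. indicator ?A ((y + x) - y) * indicator S (y + x) \<partial>lborel)"
      by (simp add: add.commute)
    also have "\<dots> = (\<integral>\<^sup>+x. indicator ?A (x - y) * indicator S x \<partial>distr lborel borel (\<lambda>x. y + x))"
      by (subst nn_integral_distr) auto
    finally show "(\<integral>\<^sup>+x. indicator ?A x * indicator S (x + y) \<partial>lborel) =
       (\<integral>\<^sup>+x. indicator ?A (x - y) * indicator S x \<partial>lborel)"
      by (simp add: lborel_distr_plus)
  qed
  also have "\<dots> = (\<integral>\<^sup>+x. (\<integral>\<^sup>+y. indicator ?A (x - y) * indicator S x \<partial>N) \<partial>lborel)"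
    by (rule Fubini') measurable
  also have "\<dots> = emeasure N ?A * emeasure lborel S"
  proof -
    have "(\<integral>\<^sup>+y. indicator ?A (x - y) * indicator S x \<partial>N) = emeasure N ?A * indicator S x" for x
    proof -
      have "(\<integral>\<^sup>+y. indicator ?A (x - y) \<partial>N) = (\<integral>\<^sup>+y. indicator ((\<lambda>y. - x + y) -` ?A) y \<partial>N)"
        by (simp add: indicator_def norm_minus_commute)
      also have "\<dots> = emeasure N ?A" using inv[of ?A "- x"] pre[of ?A "- x"] by simp
      finally show ?thesis by (subst nn_integral_multc) auto
    qed
    then show ?thesis by (simp add: nn_integral_cmult)
  qed
  finally show ?thesis .
qed

lemma emeasure_lborel_ball_pos: "0 < r \<Longrightarrow> 0 < emeasure lborel (ball (c::'a::euclidean_space) r)"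
  using content_ball_pos[of r c] by (simp add: measure_def enn2real_positive_iff)

text \<open>The image measure of \<open>lborel\<close> under \<open>f\<close> is again translation
  invariant, hence proportional to \<open>lborel\<close>; evaluating both on the unit ball gives the
  ratio.\<close>

lemma emeasure_lborel_linear_vimage:
  fixes f :: "'a::euclidean_space \<Rightarrow> 'a"
  assumes f: "linear f" "inj f" and S: "S \<in> sets borel"
  shows "emeasure lborel (ball 0 1 :: 'a set) * emeasure lborel (f -` S) =
    emeasure lborel (f -` ball 0 1) * emeasure lborel S"
proof -
  obtain g where g: "linear g" "\<And>x. g (f x) = x" "\<And>x. f (g x) = x"
    using linear_injective_isomorphism[OF f] by auto
  have meas[measurable]: "f \<in> borel_measurable borel" "g \<in> borel_measurable borel"
    using f(1) g(1) by (auto intro!: borel_measurable_continuous_onI linear_continuous_on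
        simp: linear_conv_bounded_linear)
  define N where "N = distr lborel borel f"
  \<comment> \<open>\<open>N\<close> is sigma-finite because its image under the inverse
    \<open>g\<close> is.\<close>
  have "distr N borel g = lborel"
    by (simp add: N_def distr_distr comp_def g distr_id2)
  then have sf: "sigma_finite_measure N"
    using sigma_finite_measure_distr[of N borel g] by (simp add: N_def sigma_finite_lborel)
  have eN: "emeasure N T = emeasure lborel (f -` T)" if "T \<in> sets borel" for T
    using that by (simp add: N_def emeasure_distr)
  have inv: "emeasure N ((\<lambda>y. x + y) -` T) = emeasure N T" if T[measurable]: "T \<in> sets borel" for x T
  proof -
    have "f -` ((\<lambda>y. x + y) -` T) = (\<lambda>y. g x + y) -` (f -` T)"
      by (auto simp: linear_add[OF f(1)] g)
    moreover have "emeasure lborel ((\<lambda>y. g x + y) -` (f -` T)) = emeasure lborel (f -` T)"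
      using emeasure_distr[of "(+) (g x)" lborel borel "f -` T"] measurable_sets_borel[OF meas(1) T]
      by (simp add: lborel_distr_plus)
    moreover have "(\<lambda>y. x + y) -` T \<in> sets borel"
      by (rule measurable_sets_borel[of _ borel]) auto
    ultimately show ?thesis by (simp add: eN)
  qed
  have "sets N = sets borel" by (simp add: N_def)
  from translation_invariant_proportional_lborel[OF this sf inv S]
  show ?thesis using S by (simp add: eN)
qed

text \<open>An orthogonal map preserves the unit ball, so the proportionality factor is 1; the
  volume of the ball is positive and finite and cancels.\<close>

lemma lborel_distr_orthogonal:
  fixes f :: "'a::euclidean_space \<Rightarrow> 'a"
  assumes f: "orthogonal_transformation f"
  shows "distr lborel borel f = lborel"
proof (rule measure_eqI)
  show "sets (distr lborel borel f) = sets lborel" by simp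
  have lin: "linear f" "inj f"
    using f by (auto simp: orthogonal_transformation_linear orthogonal_transformation_inj)
  have [measurable]: "f \<in> borel_measurable borel"
    using lin(1) by (auto intro!: borel_measurable_continuous_onI linear_continuous_on
        simp: linear_conv_bounded_linear)
  fix S assume "S \<in> sets (distr lborel borel f)"
  then have S[measurable]: "S \<in> sets borel" by simp
  have "f -` ball 0 1 = ball 0 1"
    using f by (auto simp: orthogonal_transformation_norm)
  then have "emeasure lborel (ball 0 1 :: 'a set) * emeasure lborel (f -` S) =
      emeasure lborel (ball 0 1 :: 'a set) * emeasure lborel S"
    using emeasure_lborel_linear_vimage[OF lin S] by simp
  then have "emeasure lborel (f -` S) = emeasure lborel S"
    using emeasure_lborel_ball_pos[of 1 "0::'a"] emeasure_lborel_ball_finite[of "0::'a" 1]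
    by (subst (asm) ennreal_mult_cancel_left) auto
  then show "emeasure (distr lborel borel f) S = emeasure lborel S"
    by (simp add: emeasure_distr)
qed

text \<open>The factor is the volume of the image of the unit ball relative to that of the ball. It
  is finite because the image is bounded, and positive because the image is open and
  nonempty.\<close>

lemma emeasure_lborel_linear_image:
  fixes f :: "'a::euclidean_space \<Rightarrow> 'a"
  assumes f: "linear f" "inj f"
  obtains c :: real where "0 < c"
    "\<And>S. S \<in> sets borel \<Longrightarrow> emeasure lborel (f ` S) = ennreal c * emeasure lborel S"
proof -
  obtain g where g: "linear g" "\<And>x. g (f x) = x" "\<And>x. f (g x) = x"
    using linear_injective_isomorphism[OF f] by auto
  have "inj g" by (metis g(3) injI)
  have im: "f ` S = g -` S" for S
    using g(2,3) by (auto simp: image_iff) metis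
  let ?A = "ball 0 1 :: 'a set"
  have "open (f ` ?A)" by (rule open_bijective_linear_image_eq[THEN iffD2])
    (auto simp: f bij_def linear_injective_imp_surjective)
  then obtain r where r: "0 < r" "ball 0 r \<subseteq> f ` ?A"
    by (metis centre_in_ball imageI linear_0[OF f(1)] open_contains_ball zero_less_one)
  have "bounded (f ` ?A)"
    using f(1) by (intro bounded_linear_image) (auto simp: linear_conv_bounded_linear)
  then have fin: "emeasure lborel (f ` ?A) < \<infinity>"
    using emeasure_bounded_finite by blast
  have "f ` ?A \<in> sets borel" using \<open>open (f ` ?A)\<close> by simp
  then have "0 < emeasure lborel (f ` ?A)"
    using emeasure_lborel_ball_pos[OF r(1), of "0::'a"] emeasure_mono[OF r(2), of lborel] by simp
  then have pos: "0 < measure lborel (f ` ?A)" using fin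
    by (simp add: measure_def enn2real_positive_iff)
  have pos': "0 < measure lborel ?A" by (simp add: content_ball_pos)
  show ?thesis
  proof (rule that[of "measure lborel (f ` ?A) / measure lborel ?A"])
    show "0 < measure lborel (f ` ?A) / measure lborel ?A" using pos pos' by simp
    fix S :: "'a set" assume S: "S \<in> sets borel"
    have A: "emeasure lborel ?A = ennreal (measure lborel ?A)"
      "emeasure lborel (f ` ?A) = ennreal (measure lborel (f ` ?A))"
      using fin emeasure_lborel_ball_finite[of "0::'a" 1]
      by (auto intro!: emeasure_eq_ennreal_measure)
    have "ennreal (measure lborel ?A) * emeasure lborel (f ` S) =
        ennreal (measure lborel (f ` ?A)) * emeasure lborel S"
      using emeasure_lborel_linear_vimage[OF g(1) \<open>inj g\<close> S] A by (simp add: im)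
    also have "\<dots> = ennreal (measure lborel ?A) *
        (ennreal (measure lborel (f ` ?A) / measure lborel ?A) * emeasure lborel S)"
      using pos' pos by (simp add: mult.assoc[symmetric] ennreal_mult[symmetric])
    finally show "emeasure lborel (f ` S) =
        ennreal (measure lborel (f ` ?A) / measure lborel ?A) * emeasure lborel S"
      using pos' by (subst (asm) ennreal_mult_cancel_left) auto
  qed
qed

section \<open>Orthonormal coordinates\<close>

lemma orthonormal_basis_of_inner:
  assumes "orthonormal_basis_of B U" "u \<in> B" "v \<in> B"
  shows "u \<bullet> v = (if u = v then 1 else 0)"
  using assms unfolding orthonormal_basis_of_def
  by (auto simp: pairwise_def orthogonal_def norm_eq_1)

lemma orthonormal_basis_of_independent:
  assumes "orthonormal_basis_of B U"
  shows "independent B"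
  using assms unfolding orthonormal_basis_of_def
  by (intro pairwise_orthogonal_independent) auto

lemma orthonormal_basis_of_finite:
  fixes U :: "'a::euclidean_space set"
  assumes "orthonormal_basis_of B U"
  shows "finite B"
  using orthonormal_basis_of_independent[OF assms] by (rule independent_imp_finite)

lemma orthonormal_basis_of_expansion:
  fixes U :: "'a::euclidean_space set"
  assumes B: "orthonormal_basis_of B U" and x: "x \<in> U"
  shows "(\<Sum>u\<in>B. (x \<bullet> u) *\<^sub>R u) = x"
proof -
  have fin: "finite B" using B by (rule orthonormal_basis_of_finite)
  have "x \<in> span B" using B x by (simp add: orthonormal_basis_of_def)
  then obtain c where c: "x = (\<Sum>v\<in>B. c v *\<^sub>R v)"
    using span_finite[OF fin] by auto
  have "x \<bullet> u = c u" if "u \<in> B" for u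
    using that fin
    by (simp add: c inner_sum_left orthonormal_basis_of_inner[OF B] if_distrib cong: if_cong)
  then show ?thesis by (simp add: c)
qed

text \<open>A bijection from the standard basis to \<open>B\<close> extends to an orthogonal map.
  This map preserves \<open>lborel\<close> and turns coordinates with respect to \<open>B\<close>
  into standard ones, for which the product formula on boxes is known.\<close>

lemma lborel_orthonormal_coordinates:
  fixes B :: "'a::euclidean_space set"
  assumes B: "orthonormal_basis_of B UNIV"
  shows "(\<Pi>\<^sub>M u\<in>B. lborel) = distr lborel (\<Pi>\<^sub>M u\<in>B. lborel) (\<lambda>x. \<lambda>u\<in>B. x \<bullet> u)"
proof -
  interpret product_sigma_finite "\<lambda>_::'a. lborel :: real measure" by standard
  have fin: "finite B" using B by (rule orthonormal_basis_of_finite)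
  have "card B = card (Basis :: ('a) set)"
    using B orthonormal_basis_of_independent[OF B]
    by (metis dim_UNIV dim_eq_card_independent dim_span orthonormal_basis_of_def)
  then obtain g where g: "bij_betw g (Basis :: ('a) set) B"
    using finite_same_card_bij[of "Basis :: ('a) set" B] fin by auto
  define f where "f x = (\<Sum>b\<in>Basis. (x \<bullet> b) *\<^sub>R g b)" for x :: "'a"
  have gB: "g b \<in> B" if "b \<in> Basis" for b using g that by (auto simp: bij_betw_def)
  have gg: "g b \<bullet> g b' = (if b = b' then 1 else 0)" if "b \<in> Basis" "b' \<in> Basis" for b b'
    using orthonormal_basis_of_inner[OF B gB gB] that bij_betw_imp_inj_on[OF g]
    by (auto simp: inj_on_def)
  have fg: "f x \<bullet> g b = x \<bullet> b" if "b \<in> Basis" for x b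
    using that by (simp add: f_def inner_sum_left gg if_distrib cong: if_cong)
  have lin: "linear f"
    by (rule linearI) (simp_all add: f_def inner_add_left scaleR_add_left sum.distrib
        scaleR_sum_right)
  have "f x \<bullet> f y = x \<bullet> y" for x y
    by (subst (2) f_def) (simp add: inner_sum_right fg euclidean_inner[of x y] mult.commute)
  with lin have orth: "orthogonal_transformation f"
    by (simp add: orthogonal_transformation_def)
  have [measurable]: "f \<in> borel_measurable borel"
    using lin by (intro borel_measurable_continuous_onI linear_continuous_on)
      (simp add: linear_conv_bounded_linear[symmetric])
  have [measurable]: "(\<lambda>x. \<lambda>u\<in>B. x \<bullet> u) \<in> borel \<rightarrow>\<^sub>M (\<Pi>\<^sub>M u\<in>B. lborel)"
    by measurable
  show ?thesis
  proof (rule PiM_eqI[OF fin, symmetric])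
    show "sets (distr lborel (\<Pi>\<^sub>M u\<in>B. lborel) (\<lambda>x. \<lambda>u\<in>B. x \<bullet> u)) = sets (\<Pi>\<^sub>M u\<in>B. lborel)"
      by simp
    fix A :: "'a \<Rightarrow> real set" assume A: "\<And>i. i \<in> B \<Longrightarrow> A i \<in> sets lborel"
    have S: "(\<lambda>x. \<lambda>u\<in>B. x \<bullet> u) -` (Pi\<^sub>E B A) \<in> sets borel"
      using fin A
      by (intro measurable_sets_borel[where M="\<Pi>\<^sub>M u\<in>B. (lborel :: real measure)"] sets_PiM_I_finite) auto
    have "emeasure (distr lborel (\<Pi>\<^sub>M u\<in>B. lborel) (\<lambda>x. \<lambda>u\<in>B. x \<bullet> u)) (Pi\<^sub>E B A) =
       emeasure lborel ((\<lambda>x. \<lambda>u\<in>B. x \<bullet> u) -` (Pi\<^sub>E B A))"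
      using fin A by (simp add: emeasure_distr sets_PiM_I_finite)
    also have "\<dots> = emeasure (distr lborel borel f) ((\<lambda>x. \<lambda>u\<in>B. x \<bullet> u) -` (Pi\<^sub>E B A))"
      by (simp add: lborel_distr_orthogonal[OF orth])
    also have "\<dots> = emeasure lborel (f -` ((\<lambda>x. \<lambda>u\<in>B. x \<bullet> u) -` (Pi\<^sub>E B A)))"
      using S by (simp add: emeasure_distr)
    also have "\<dots> = (\<integral>\<^sup>+x. indicator (f -` ((\<lambda>x. \<lambda>u\<in>B. x \<bullet> u) -` (Pi\<^sub>E B A))) x \<partial>lborel)"
      using measurable_sets_borel[OF _ S, of f] by simp
    also have "\<dots> = (\<integral>\<^sup>+x. (\<Prod>b\<in>Basis. indicator (A (g b)) (x \<bullet> b)) \<partial>lborel)"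
    proof (intro nn_integral_cong)
      fix x :: "'a"
      have "(\<forall>u\<in>B. f x \<bullet> u \<in> A u) \<longleftrightarrow> (\<forall>b\<in>Basis. x \<bullet> b \<in> A (g b))"
        using bij_betw_imp_surj_on[OF g] fg by (metis (no_types, lifting) gB imageE)
      then show "indicator (f -` ((\<lambda>x. \<lambda>u\<in>B. x \<bullet> u) -` (Pi\<^sub>E B A))) x =
        (\<Prod>b\<in>Basis. indicator (A (g b)) (x \<bullet> b) :: ennreal)"
        by (auto simp: indicator_def PiE_iff prod_zero_iff)
    qed
    also have "\<dots> = (\<Prod>b\<in>Basis. emeasure lborel (A (g b)))"
      using A gB by (subst nn_integral_lborel_prod) auto
    also have "\<dots> = (\<Prod>u\<in>B. emeasure lborel (A u))"
      by (rule prod.reindex_bij_betw[OF g])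
    finally show "emeasure (distr lborel (\<Pi>\<^sub>M u\<in>B. lborel) (\<lambda>x. \<lambda>u\<in>B. x \<bullet> u)) (Pi\<^sub>E B A) =
      (\<Prod>u\<in>B. emeasure lborel (A u))" .
  qed
qed

text \<open>The form in which Fubini can split off the coordinate along a chosen unit
  vector.\<close>

lemma lborel_eq_orthonormal:
  fixes B :: "'a::euclidean_space set"
  assumes B: "orthonormal_basis_of B UNIV"
  shows "lborel = distr (\<Pi>\<^sub>M u\<in>B. lborel) borel (\<lambda>f. \<Sum>u\<in>B. f u *\<^sub>R u)"
proof -
  have [measurable]: "(\<lambda>x. \<lambda>u\<in>B. x \<bullet> u) \<in> borel \<rightarrow>\<^sub>M (\<Pi>\<^sub>M u\<in>B. lborel)"
    by measurable
  have "distr (\<Pi>\<^sub>M u\<in>B. lborel) borel (\<lambda>f. \<Sum>u\<in>B. f u *\<^sub>R u) =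
     distr lborel borel (\<lambda>x. \<Sum>u\<in>B. (x \<bullet> u) *\<^sub>R u)"
    by (subst lborel_orthonormal_coordinates[OF B])
      (simp add: distr_distr comp_def cong: sum.cong)
  also have "\<dots> = distr lborel borel id"
    by (simp add: orthonormal_basis_of_expansion[OF B] id_def[symmetric])
  also have "\<dots> = lborel" by (simp add: id_def distr_id2)
  finally show ?thesis by simp
qed

section \<open>Sets of positive and of infinite measure\<close>

lemma emeasure_lborel_open_pos:
  fixes S :: "'a::euclidean_space set"
  assumes "open S" "S \<noteq> {}"
  shows "0 < emeasure lborel S"
proof -
  obtain x r where r: "0 < r" "ball x r \<subseteq> S"
    using assms by (meson all_not_in_conv open_contains_ball)
  have "emeasure lborel (ball x r) \<le> emeasure lborel S"
    using assms r by (intro emeasure_mono) auto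
  with emeasure_lborel_ball_pos[OF r(1), of x] show ?thesis by simp
qed

text \<open>A ball inside \<open>S\<close> can be moved along \<open>w\<close> without leaving
  \<open>S\<close>, which yields infinitely many disjoint balls of equal volume.\<close>

lemma emeasure_lborel_recession_direction:
  fixes S :: "'a::euclidean_space set"
  assumes S[measurable]: "S \<in> sets borel" and int: "interior S \<noteq> {}" and w: "w \<noteq> 0"
    and rec: "\<And>x s. x \<in> S \<Longrightarrow> 0 \<le> s \<Longrightarrow> x + s *\<^sub>R w \<in> S"
  shows "emeasure lborel S = \<infinity>"
proof (rule ccontr)
  assume fin: "emeasure lborel S \<noteq> \<infinity>"
  obtain x r where r: "0 < r" "ball x r \<subseteq> S"
    using int by (metis all_not_in_conv mem_interior)
  \<comment> \<open>Each shift by \<open>s *\<^sub>R w\<close> has length \<open>2 * r\<close>, just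
    enough to make open balls of radius \<open>r\<close> disjoint.\<close>
  define s where "s = 2 * r / norm w"
  have s: "0 < s" "s * norm w = 2 * r" using w r by (auto simp: s_def)
  define D where "D k = ball (x + (real k * s) *\<^sub>R w) r" for k :: nat
  define m where "m = unit_ball_vol (DIM('a)) * r ^ DIM('a)"
  have m: "0 < m" using r by (simp add: m_def)
  have DS: "D k \<subseteq> S" for k
  proof
    fix y assume "y \<in> D k"
    then have "y - (real k * s) *\<^sub>R w \<in> S"
      using r(2) by (auto simp: D_def dist_norm algebra_simps subset_iff)
    from rec[OF this, of "real k * s"] s show "y \<in> S" by simp
  qed
  have disj: "disjoint_family D"
    unfolding disjoint_family_on_def
  proof (intro ballI impI)
    fix k l :: nat assume kl: "k \<noteq> l"
    have "(x + (real k * s) *\<^sub>R w) - (x + (real l * s) *\<^sub>R w) = ((real k - real l) * s) *\<^sub>R w"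
      by (simp add: algebra_simps)
    then have "dist (x + (real k * s) *\<^sub>R w) (x + (real l * s) *\<^sub>R w) = \<bar>real k - real l\<bar> * (2 * r)"
      using s by (simp add: dist_norm abs_mult)
    moreover have "1 \<le> \<bar>real k - real l\<bar>" using kl by linarith
    ultimately have "r + r \<le> dist (x + (real k * s) *\<^sub>R w) (x + (real l * s) *\<^sub>R w)"
      using r(1) mult_right_mono[of 1 "\<bar>real k - real l\<bar>" "2 * r"] by linarith
    then show "D k \<inter> D l = {}"
      unfolding D_def by (rule disjoint_ballI)
  qed
  have N: "real N * m \<le> measure lborel S" for N
  proof -
    have "ennreal (real N * m) = (\<Sum>k<N. emeasure lborel (D k))"
      using r m by (simp add: D_def emeasure_ball m_def[symmetric] ennreal_mult ennreal_of_nat_eq_real_of_nat)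
    also have "\<dots> = emeasure lborel (\<Union>k<N. D k)"
      using disj by (intro sum_emeasure) (auto simp: D_def disjoint_family_on_def)
    also have "\<dots> \<le> emeasure lborel S"
      using DS by (intro emeasure_mono) auto
    finally show ?thesis using fin m
      by (simp add: emeasure_eq_ennreal_measure)
  qed
  obtain N where "measure lborel S < real N * m"
    using reals_Archimedean3[OF m] by blast
  with N[of N] show False by simp
qed

section \<open>Volume of hyperplane sections of cones\<close>

text \<open>
  The section at level \<open>s\<close> of the cone is the section at level 1 scaled by \<open>s\<close>, up to a translation
  that the product measure does not see; integrate \<open>s ^ (n - 1)\<close> over the levels.
  Both sides may be infinite.
\<close>

lemma section_volume_hplane:
  fixes b :: "'a::euclidean_space"
  assumes b: "b \<noteq> 0" and K: "closed K"
    and cone: "\<And>x s. x \<in> K \<Longrightarrow> 0 < s \<Longrightarrow> s *\<^sub>R x \<in> K"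
  shows "section_volume K (hplane b) =
    ennreal (DIM('a) * norm b) * emeasure lborel {x \<in> K. 0 < b \<bullet> x \<and> b \<bullet> x \<le> 1}"
proof -
  define U where "U = {x. b \<bullet> x = 0}"
  \<comment> \<open>\<open>p\<close> and \<open>B\<close> repeat the choices in
    \<open>affine_lborel\<close>; only their characteristic properties are used.\<close>
  define p where "p = (SOME p. p \<in> hplane b)"
  define B where "B = (SOME B. orthonormal_basis_of B ((\<lambda>x. x - p) ` hplane b))"
  have "b /\<^sub>R (b \<bullet> b) \<in> hplane b" using b by (simp add: hplane_def)
  then have "p \<in> hplane b" unfolding p_def by (rule someI)
  then have p: "b \<bullet> p = 1" by (simp add: hplane_def)
  have "(\<lambda>x. x - p) ` hplane b = U"
  proof (intro set_eqI iffI)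
    fix x assume "x \<in> U"
    then show "x \<in> (\<lambda>x. x - p) ` hplane b"
      by (intro image_eqI[of _ _ "x + p"]) (auto simp: U_def hplane_def p inner_add_right)
  qed (auto simp: U_def hplane_def p inner_diff_right)
  moreover have "subspace U" by (simp add: U_def subspace_hyperplane)
  then have "\<exists>B. orthonormal_basis_of B U"
    unfolding orthonormal_basis_of_def by (meson orthonormal_basis_subspace)
  ultimately have B: "orthonormal_basis_of B U"
    unfolding B_def by (metis someI_ex)
  have fin[simp]: "finite B" using B by (rule orthonormal_basis_of_finite)
  have BU: "B \<subseteq> U" using B span_superset by (auto simp: orthonormal_basis_of_def)
  \<comment> \<open>The unit normal completes the basis \<open>B\<close> of the direction space to
    an orthonormal basis of the whole space.\<close>
  define v where "v = b /\<^sub>R norm b"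
  have bv: "b \<bullet> v = norm b" "norm v = 1" "b = norm b *\<^sub>R v"
    using b by (simp_all add: v_def dot_square_norm power2_eq_square)
  have vB: "v \<notin> B" using BU bv(1) b by (auto simp: U_def)
  have orth: "orthonormal_basis_of (insert v B) UNIV"
    unfolding orthonormal_basis_of_def
  proof (intro conjI)
    have "orthogonal v u \<and> orthogonal u v" if "u \<in> B" for u
      using that BU b by (auto simp: U_def v_def orthogonal_def inner_commute)
    then show "pairwise orthogonal (insert v B)"
      using B by (auto simp: pairwise_insert orthonormal_basis_of_def)
    show "\<forall>u\<in>insert v B. norm u = 1" using B bv(2) by (simp add: orthonormal_basis_of_def)
    have "x \<in> span (insert v B)" for x
    proof -
      have "x - (x \<bullet> v) *\<^sub>R v \<in> U"
        using arg_cong[OF bv(3), of "\<lambda>z. z \<bullet> x"]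
        by (simp add: U_def inner_diff_right bv(1) inner_commute[of x v])
      then have "x - (x \<bullet> v) *\<^sub>R v \<in> span (insert v B)"
        using B span_mono[of B "insert v B"] by (auto simp: orthonormal_basis_of_def)
      moreover have "(x \<bullet> v) *\<^sub>R v \<in> span (insert v B)"
        by (simp add: span_base span_scale)
      ultimately show ?thesis by (metis diff_add_cancel span_add)
    qed
    then show "span (insert v B) = UNIV" by auto
  qed
  have dim: "DIM('a) = Suc (card B)"
    using orth orthonormal_basis_of_independent[OF orth] fin vB
    by (metis card_insert_disjoint dim_UNIV dim_eq_card_independent dim_span orthonormal_basis_of_def)
  let ?k = "card B"
  define M where "M = (\<Pi>\<^sub>M u\<in>B. (lborel :: real measure))"
  define F where "F f = (\<Sum>u\<in>B. f u *\<^sub>R u)" for f :: "'a \<Rightarrow> real"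
  have F[measurable]: "F \<in> borel_measurable M"
    unfolding F_def M_def by measurable
  have FU: "b \<bullet> F f = 0" for f
    using BU by (auto simp: F_def inner_sum_right U_def intro!: sum.neutral)
  have [measurable]: "K \<in> sets borel" "hplane b \<in> sets borel"
    using K by (auto simp: hplane_def intro!: borel_closed closed_hyperplane)
  \<comment> \<open>The volume of the slice of \<open>K\<close> through \<open>q\<close> parallel to
    \<open>hplane b\<close>, in coordinates with origin \<open>q\<close>.\<close>
  define G where "G q = emeasure M {f \<in> space M. q + F f \<in> K}" for q
  have "section_volume K (hplane b) = emeasure (distr M borel (\<lambda>f. p + F f)) (K \<inter> hplane b)"
    by (simp add: section_volume_def affine_lborel_def p_def[symmetric] B_def[symmetric] Let_def
        M_def F_def)
  also have "\<dots> = G p"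
    unfolding G_def by (subst emeasure_distr)
      (auto intro!: arg_cong[where f="emeasure M"] simp: hplane_def inner_add_right p FU)
  finally have sv: "section_volume K (hplane b) = G p" .
  have G_scale: "G (y *\<^sub>R v) = ennreal ((y * norm b) ^ ?k) * G p" if y: "0 < y" for y
  proof -
    define s where "s = y * norm b"
    have s: "0 < s" using y b by (simp add: s_def)
    \<comment> \<open>The slice through \<open>y *\<^sub>R v\<close> lies at level \<open>s\<close>.
      Shrinking it by \<open>s\<close> puts it in \<open>hplane b\<close>, but with the origin of
      coordinates displaced from \<open>p\<close>; \<open>g\<close> holds the coordinates of this
      displacement before shrinking.\<close>
    define g where "g u = (y *\<^sub>R v - s *\<^sub>R p) \<bullet> u" for u
    have "y *\<^sub>R v - s *\<^sub>R p \<in> U"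
      by (simp add: U_def inner_diff_right p bv(1) s_def)
    then have Fg: "F g = y *\<^sub>R v - s *\<^sub>R p"
      unfolding F_def g_def by (rule orthonormal_basis_of_expansion[OF B])
    let ?T = "\<lambda>f. \<lambda>u\<in>B. g u / s + (1 / s) * f u"
    have "F (?T f) = (1 / s) *\<^sub>R (F g + F f)" for f
      by (simp add: F_def scaleR_sum_right scaleR_add_left sum.distrib scaleR_add_right cong: sum.cong)
    then have FT: "p + F (?T f) = (1 / s) *\<^sub>R (y *\<^sub>R v + F f)" for f
      using s by (simp add: Fg algebra_simps)
    have K_iff: "(1 / s) *\<^sub>R x \<in> K \<longleftrightarrow> x \<in> K" for x
      using cone[of "(1 / s) *\<^sub>R x" s] cone[of x "1 / s"] s by auto
    have "?T f \<in> space M" for f by (auto simp: M_def space_PiM)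
    then have KT: "?T f \<in> {f \<in> space M. p + F f \<in> K} \<longleftrightarrow> y *\<^sub>R v + F f \<in> K" for f
      by (simp only: mem_Collect_eq FT K_iff simp_thms)
    have "G p = ennreal ((1 / s) ^ ?k) *
        emeasure M (?T -` {f \<in> space M. p + F f \<in> K} \<inter> space M)"
      unfolding G_def M_def using s
      by (intro PiM_lborel_affine fin) (auto simp: M_def[symmetric])
    also have "?T -` {f \<in> space M. p + F f \<in> K} \<inter> space M = {f \<in> space M. y *\<^sub>R v + F f \<in> K}"
      unfolding vimage_def KT by auto
    finally have "G p = ennreal ((1 / s) ^ ?k) * G (y *\<^sub>R v)" by (simp add: G_def)
    then have "ennreal (s ^ ?k) * G p = ennreal (s ^ ?k * (1 / s) ^ ?k) * G (y *\<^sub>R v)"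
      using s by (simp add: ennreal_mult mult.assoc)
    also have "s ^ ?k * (1 / s) ^ ?k = 1" using s by (simp add: power_mult_distrib[symmetric])
    finally show ?thesis by (simp add: s_def)
  qed
  define T where "T = {x \<in> K. 0 < b \<bullet> x \<and> b \<bullet> x \<le> 1}"
  have [measurable]: "T \<in> sets borel" unfolding T_def by measurable
  interpret product_sigma_finite "\<lambda>_::'a. lborel :: real measure" by standard
  have "emeasure lborel T = (\<integral>\<^sup>+x. indicator T x \<partial>lborel)" by simp
  also have "\<dots> = (\<integral>\<^sup>+f. indicator T (\<Sum>u\<in>insert v B. f u *\<^sub>R u) \<partial>(\<Pi>\<^sub>M u\<in>insert v B. lborel))"
    by (subst lborel_eq_orthonormal[OF orth], subst nn_integral_distr) measurable
  also have "\<dots> = (\<integral>\<^sup>+y. (\<integral>\<^sup>+f. indicator T (\<Sum>u\<in>insert v B. (f(v := y)) u *\<^sub>R u) \<partial>M) \<partial>lborel)"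
    unfolding M_def by (rule product_nn_integral_insert_rev[OF fin vB]) measurable
  also have "\<dots> = (\<integral>\<^sup>+y. ennreal ((y * norm b) ^ ?k) * indicator {0..1 / norm b} y * G p \<partial>lborel)"
  proof (rule nn_integral_cong_AE)
    \<comment> \<open>At \<open>y = 0\<close> the two sides may differ: \<open>T\<close> omits level
      0, whereas the closed interval needed for the integration below contains it.\<close>
    have "AE y in lborel. y \<noteq> (0::real)" by (rule AE_lborel_singleton)
    then show "AE y in lborel. (\<integral>\<^sup>+f. indicator T (\<Sum>u\<in>insert v B. (f(v := y)) u *\<^sub>R u) \<partial>M) =
       ennreal ((y * norm b) ^ ?k) * indicator {0..1 / norm b} y * G p"
    proof eventually_elim
      fix y :: real assume y0: "y \<noteq> 0"
      have "(\<Sum>u\<in>insert v B. (f(v := y)) u *\<^sub>R u) = y *\<^sub>R v + F f" for f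
        using vB by (auto simp: F_def intro!: sum.cong)
      then have eq: "(\<integral>\<^sup>+f. indicator T (\<Sum>u\<in>insert v B. (f(v := y)) u *\<^sub>R u) \<partial>M) =
          (\<integral>\<^sup>+f. indicator T (y *\<^sub>R v + F f) \<partial>M)" by simp
      have bT: "y *\<^sub>R v + F f \<in> T \<longleftrightarrow> y *\<^sub>R v + F f \<in> K \<and> 0 < y \<and> y \<le> 1 / norm b" for f
        using b by (simp add: T_def inner_add_right FU bv(1) field_simps zero_less_mult_iff)
      show "(\<integral>\<^sup>+f. indicator T (\<Sum>u\<in>insert v B. (f(v := y)) u *\<^sub>R u) \<partial>M) =
         ennreal ((y * norm b) ^ ?k) * indicator {0..1 / norm b} y * G p"
      proof (cases "0 < y \<and> y \<le> 1 / norm b")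
        case True
        then have "(\<integral>\<^sup>+f. indicator T (y *\<^sub>R v + F f) \<partial>M) =
          (\<integral>\<^sup>+f. indicator {f \<in> space M. y *\<^sub>R v + F f \<in> K} f \<partial>M)"
          by (intro nn_integral_cong) (auto simp: indicator_def bT)
        also have "\<dots> = G (y *\<^sub>R v)" unfolding G_def by (rule nn_integral_indicator) measurable
        finally show ?thesis unfolding eq using True by (simp add: G_scale)
      next
        case False
        then show ?thesis unfolding eq using y0 by (auto simp: bT indicator_def)
      qed
    qed
  qed
  also have "\<dots> = (\<integral>\<^sup>+y. ennreal ((y * norm b) ^ ?k) * indicator {0..1 / norm b} y \<partial>lborel) * G p"
    by (rule nn_integral_multc) measurable
  also have "(\<integral>\<^sup>+y. ennreal ((y * norm b) ^ ?k) * indicator {0..1 / norm b} y \<partial>lborel) =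
      ennreal ((1 / norm b * norm b) ^ Suc ?k / (norm b * Suc ?k) - (0 * norm b) ^ Suc ?k / (norm b * Suc ?k))"
  proof (rule nn_integral_FTC_Icc)
    fix y :: real
    show "DERIV (\<lambda>y. (y * norm b) ^ Suc ?k / (norm b * Suc ?k)) y :> (y * norm b) ^ ?k"
      using b by (auto intro!: derivative_eq_intros simp del: power_Suc) 
  qed auto
  also have "\<dots> = ennreal (1 / (norm b * Suc ?k))" using b by simp
  finally have T: "emeasure lborel T = ennreal (1 / (norm b * Suc ?k)) * G p" .
  \<comment> \<open>Stated for extended \<open>z\<close>, since \<open>G p\<close> may be
    infinite.\<close>
  have "ennreal c * (ennreal (1 / c) * z) = z" if "0 < c" for c z
    using that by (simp add: mult.assoc[symmetric] ennreal_mult[symmetric])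
  from this[of "norm b * Suc ?k"] have "G p = ennreal (norm b * Suc ?k) * emeasure lborel T"
    using b by (simp only: T) simp
  then show ?thesis by (simp only: sv dim T_def mult.commute)
qed

section \<open>Elementary facts\<close>

text \<open>The component of \<open>g\<close> orthogonal to \<open>a\<close> is orthogonal to
  \<open>g\<close>, hence to itself. This is the Lagrange multiplier rule for one linear
  constraint.\<close>

lemma parallel_if_orthogonal_complement:
  fixes a g :: "'a::real_inner"
  assumes a: "a \<noteq> 0" and orth: "\<And>h. h \<bullet> a = 0 \<Longrightarrow> h \<bullet> g = 0"
  obtains m :: real where "g = m *\<^sub>R a"
proof -
  define h where "h = g - ((g \<bullet> a) / (a \<bullet> a)) *\<^sub>R a"
  have ha: "h \<bullet> a = 0" using a by (simp add: h_def inner_diff_left)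
  have "h \<bullet> h = h \<bullet> g - ((g \<bullet> a) / (a \<bullet> a)) * (h \<bullet> a)"
    by (subst (2) h_def) (simp add: inner_diff_right)
  then have "h = 0" using orth[OF ha] ha by simp
  then show ?thesis using that by (simp add: h_def)
qed

lemma vec_angle_less_pi_half:
  assumes "vec_angle v w < pi / 2"
  shows "0 < v \<bullet> w"
proof (rule ccontr)
  assume "\<not> 0 < v \<bullet> w"
  then have "(v \<bullet> w) / (norm v * norm w) \<le> 0" by (simp add: divide_nonpos_nonneg)
  moreover have "- 1 \<le> (v \<bullet> w) / (norm v * norm w)"
  \<comment> \<open>If a vector is zero, the quotient is 0 by the convention on division; otherwise
    Cauchy-Schwarz gives the bound.\<close>
  proof (cases "norm v * norm w = 0")
    case False
    then have "0 < norm v * norm w" by (simp add: less_le)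
    moreover have "- (norm v * norm w) \<le> v \<bullet> w"
      using Cauchy_Schwarz_ineq2[of v w] by linarith
    ultimately show ?thesis by (simp add: pos_le_divide_eq)
  qed auto
  ultimately have "arccos 0 \<le> arccos ((v \<bullet> w) / (norm v * norm w))"
    by (intro arccos_le_arccos) auto
  with assms show False by (simp add: vec_angle_def)
qed

lemma gderiv_unique:
  assumes "GDERIV f x :> D" "GDERIV f x :> D'"
  shows "D = D'"
proof -
  have "(\<lambda>h. h \<bullet> D) = (\<lambda>h. h \<bullet> D')"
    using assms unfolding gderiv_def by (rule has_derivative_unique)
  then have "(D - D') \<bullet> D = (D - D') \<bullet> D'" by metis
  then have "(D - D') \<bullet> (D - D') = 0" by (simp add: inner_diff_right)
  then show ?thesis by simp
qed

text \<open>The inequality of arithmetic and geometric means for a mean of at most 1, obtained by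
  summing \<open>ln x \<le> x - 1\<close>.\<close>

lemma prod_le_1_if_sum_le_card:
  fixes x :: "'a \<Rightarrow> real"
  assumes "finite S" and x: "\<And>i. i \<in> S \<Longrightarrow> 0 < x i" and sum: "(\<Sum>i\<in>S. x i) \<le> card S"
  shows "(\<Prod>i\<in>S. x i) \<le> 1"
proof -
  have "(\<Sum>i\<in>S. ln (x i)) \<le> (\<Sum>i\<in>S. x i - 1)"
    using x by (intro sum_mono ln_le_minus_one) auto
  also have "\<dots> \<le> 0" using sum by (simp add: sum_subtractf)
  finally have "exp (\<Sum>i\<in>S. ln (x i)) \<le> 1" by simp
  then show ?thesis using x assms(1) by (simp add: exp_sum)
qed

section \<open>Sections of a hyperangle\<close>

text \<open>Indexing the generators by the coordinate type makes \<open>K\<close> a linear image of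
  the nonnegative orthant of the same space.\<close>

locale hyperangle_basis =
  fixes e :: "'n::finite \<Rightarrow> real^'n" and K :: "(real^'n) set"
  assumes inj_e: "inj e" and independent_e: "independent (range e)"
    and K_eq: "K = hyperangle (range e)"
begin

definition comb :: "real^'n \<Rightarrow> real^'n" where
  "comb t = (\<Sum>i\<in>UNIV. (t $ i) *\<^sub>R e i)"

definition admissible :: "real^'n \<Rightarrow> bool" where
  "admissible b \<longleftrightarrow> (\<forall>i. 0 < b \<bullet> e i)"

lemma linear_comb: "linear comb"
  by (rule linearI) (simp_all add: comb_def scaleR_add_left sum.distrib scaleR_sum_right)

lemma inj_comb: "inj comb"
proof (subst linear_injective_0[OF linear_comb], intro allI impI)
  fix t assume t: "comb t = 0"
  \<comment> \<open>Independence speaks of sums over the set of generators, so the coefficients are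
    transported along \<open>inv e\<close>.\<close>
  have "(\<Sum>v\<in>range e. (t $ inv e v) *\<^sub>R v) = comb t"
    by (simp add: comb_def sum.reindex[OF inj_e] inv_f_f[OF inj_e])
  then have "\<forall>v\<in>range e. t $ inv e v = 0"
    using independentD[OF independent_e _ order_refl, of "\<lambda>v. t $ inv e v"] t by auto
  then show "t = 0" by (auto simp: inv_f_f[OF inj_e] vec_eq_iff)
qed

lemma surj_comb: "surj comb"
  by (intro linear_injective_imp_surjective linear_comb inj_comb refl)

lemma inner_comb: "x \<bullet> comb t = (\<Sum>i\<in>UNIV. t $ i * (x \<bullet> e i))"
  by (simp add: comb_def inner_sum_right)

lemma comb_axis: "comb (axis i 1) = e i"
  by (simp add: comb_def axis_def if_distrib[of "\<lambda>x. x *\<^sub>R _"] cong: if_cong)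

lemma K_eq_comb: "K = comb ` {t. \<forall>i. 0 \<le> t $ i}"
proof (intro set_eqI iffI)
  fix x assume "x \<in> K"
  then obtain t where t: "x = (\<Sum>v\<in>range e. t v *\<^sub>R v)" "\<forall>v\<in>range e. 0 \<le> t v"
    by (auto simp: K_eq hyperangle_def)
  then have x: "x = comb (\<chi> i. t (e i))"
    by (simp add: comb_def sum.reindex[OF inj_e])
  show "x \<in> comb ` {t. \<forall>i. 0 \<le> t $ i}"
    unfolding x using t(2) by (intro imageI) simp
next
  fix x assume "x \<in> comb ` {t. \<forall>i. 0 \<le> t $ i}"
  then obtain t where t: "x = comb t" "\<forall>i. 0 \<le> t $ i" by auto
  have "x = (\<Sum>v\<in>range e. (t $ inv e v) *\<^sub>R v)"
    by (simp add: t comb_def sum.reindex[OF inj_e] inv_f_f[OF inj_e])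
  moreover have "\<forall>v\<in>range e. 0 \<le> t $ inv e v" using t(2) by simp
  ultimately show "x \<in> K" unfolding K_eq hyperangle_def
    by (intro CollectI exI[of _ "\<lambda>v. t $ inv e v"] conjI)
qed

lemma comb_in_K_iff: "comb t \<in> K \<longleftrightarrow> (\<forall>i. 0 \<le> t $ i)"
  by (simp add: K_eq_comb inj_image_mem_iff[OF inj_comb])

lemma e_in_K: "e i \<in> K"
  using comb_in_K_iff[of "axis i 1"] unfolding comb_axis by (simp add: axis_def)

lemma closed_K: "closed K"
proof -
  have "{t :: real^'n. \<forall>i. 0 \<le> t $ i} = (\<Inter>i. {t. 0 \<le> t $ i})" by auto
  also have "closed \<dots>"
    by (intro closed_INT ballI closed_Collect_le continuous_intros)
  finally show ?thesis
    unfolding K_eq_comb by (intro closed_injective_linear_image linear_comb inj_comb)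
qed

lemma comb_in_interior_K_iff: "comb t \<in> interior K \<longleftrightarrow> (\<forall>i. 0 < t $ i)"
proof -
  have "interior {t :: real^'n. \<forall>i. 0 \<le> t $ i} = {t. \<forall>i. 0 < t $ i}"
  proof (rule interior_unique)
    have "{t :: real^'n. \<forall>i. 0 < t $ i} = (\<Inter>i. {t. 0 < t $ i})" by auto
    also have "open \<dots>"
      by (intro open_INT ballI open_Collect_less continuous_intros) auto
    finally show "open {t :: real^'n. \<forall>i. 0 < t $ i}" .
    fix T :: "(real^'n) set" assume T: "T \<subseteq> {t. \<forall>i. 0 \<le> t $ i}" "open T"
    then have "T \<subseteq> interior {t. t $ i \<ge> 0}" for i by (intro interior_maximal) auto
    then show "T \<subseteq> {t. \<forall>i. 0 < t $ i}" by auto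
  qed (auto intro: less_imp_le)
  then show ?thesis
    by (simp add: K_eq_comb interior_injective_linear_image[OF linear_comb inj_comb]
        inj_image_mem_iff[OF inj_comb])
qed

lemma dual_cone_K: "dual_cone K = {b. \<forall>i. 0 \<le> b \<bullet> e i}"
  unfolding dual_cone_def
proof (intro Collect_cong iffI ballI allI)
  fix y x assume "\<forall>i. 0 \<le> y \<bullet> e i" "x \<in> K"
  then show "0 \<le> y \<bullet> x" by (auto simp: K_eq_comb inner_comb intro!: sum_nonneg)
qed (auto simp: e_in_K)

lemma e_nonzero: "e i \<noteq> 0"
  using independent_e dependent_zero[of "range e"] by (metis rangeI)

lemma open_admissible: "open {b. admissible b}"
proof -
  have "{b. admissible b} = (\<Inter>i. {b. 0 < b \<bullet> e i})" by (auto simp: admissible_def)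
  also have "open \<dots>"
    by (intro open_INT ballI open_Collect_less continuous_intros) auto
  finally show ?thesis .
qed

lemma interior_dual_cone_K: "interior (dual_cone K) = {b. admissible b}"
proof (rule interior_unique)
  show "{b. admissible b} \<subseteq> dual_cone K"
    by (auto simp: dual_cone_K admissible_def intro: less_imp_le)
  show "open {b. admissible b}" by (rule open_admissible)
  fix T assume T: "T \<subseteq> dual_cone K" "open T"
  show "T \<subseteq> {b. admissible b}"
  proof (clarsimp simp: admissible_def)
    fix b i assume "b \<in> T"
    then obtain r where r: "0 < r" "ball b r \<subseteq> T"
      using T open_contains_ball by blast
    \<comment> \<open>Moving from \<open>b\<close> by \<open>r / 2\<close> against
      \<open>e i\<close> stays in the ball, hence in the dual cone, and lowers the product with
      \<open>e i\<close> by a positive amount.\<close>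
    define s where "s = r / (2 * norm (e i))"
    have s: "0 < s" using r e_nonzero by (simp add: s_def)
    have "norm (s *\<^sub>R e i) = r / 2"
      using r e_nonzero[of i] by (simp add: s_def)
    then have "b - s *\<^sub>R e i \<in> dual_cone K"
      using r T by (auto simp: dist_norm subset_iff)
    then have "s * (e i \<bullet> e i) \<le> b \<bullet> e i" by (simp add: dual_cone_K inner_diff_left)
    moreover have "0 < s * (e i \<bullet> e i)" using s e_nonzero by simp
    ultimately show "0 < b \<bullet> e i" by linarith
  qed
qed

lemma admissible_nonzero: "admissible b \<Longrightarrow> b \<noteq> 0"
  by (auto simp: admissible_def)

lemma scaleR_in_K: "x \<in> K \<Longrightarrow> 0 < s \<Longrightarrow> s *\<^sub>R x \<in> K"
  by (auto simp: K_eq_comb linear_scale[OF linear_comb, symmetric] intro!: imageI)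

text \<open>\<open>K\<close> contains a nonzero direction orthogonal to \<open>b\<close>, along
  which the truncated cone is unbounded. The condition on \<open>e j\<close> excludes hyperplanes
  that miss \<open>K\<close>, whose sections have volume 0.\<close>

lemma section_volume_infinite:
  assumes i: "b \<bullet> e i \<le> 0" and j: "0 < b \<bullet> e j"
  shows "section_volume K (hplane b) = \<infinity>"
proof -
  have b: "b \<noteq> 0" using j by auto
  define T where "T = {x \<in> K. 0 < b \<bullet> x \<and> b \<bullet> x \<le> 1}"
  have [measurable]: "K \<in> sets borel" using closed_K by (rule borel_closed)
  have T[measurable]: "T \<in> sets borel" unfolding T_def by measurable
  \<comment> \<open>The coefficients make \<open>b \<bullet> w\<close> vanish, and by the sign
    conditions both are nonnegative, so \<open>w\<close> lies in \<open>K\<close>.\<close>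
  define w where "w = (b \<bullet> e j) *\<^sub>R e i - (b \<bullet> e i) *\<^sub>R e j"
  have ij: "i \<noteq> j" using i j by auto
  define c :: "real^'n" where "c = (\<chi> k. if k = i then b \<bullet> e j else if k = j then - (b \<bullet> e i) else 0)"
  have c: "w = comb c"
  proof -
    have "c = (b \<bullet> e j) *\<^sub>R axis i 1 - (b \<bullet> e i) *\<^sub>R axis j 1"
      using ij by (auto simp: c_def axis_def vec_eq_iff)
    then show ?thesis
      by (simp add: w_def linear_diff[OF linear_comb] linear_scale[OF linear_comb] comb_axis)
  qed
  have c0: "0 \<le> c $ k" for k using i j by (simp add: c_def)
  have "c \<noteq> 0" using j by (auto simp: c_def vec_eq_iff)
  then have w: "w \<noteq> 0" using c inj_comb linear_0[OF linear_comb] by (metis injD)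
  have bw: "b \<bullet> w = 0" by (simp add: w_def inner_diff_right)
  have rec: "x + s *\<^sub>R w \<in> T" if x: "x \<in> T" and s: "0 \<le> s" for x s
  proof -
    obtain t where t: "x = comb t" using surj_comb by (metis surjD)
    then have "x + s *\<^sub>R w = comb (t + s *\<^sub>R c)"
      by (simp add: c linear_add[OF linear_comb] linear_scale[OF linear_comb])
    then have "x + s *\<^sub>R w \<in> K"
      using x s t c0 by (simp add: T_def comb_in_K_iff)
    then show ?thesis using x by (simp add: T_def inner_add_right bw)
  qed
  define S where "S = {x \<in> interior K. 0 < b \<bullet> x \<and> b \<bullet> x < 1}"
  have S: "S = interior K \<inter> {x. 0 < b \<bullet> x} \<inter> {x. b \<bullet> x < 1}" by (auto simp: S_def)
  have "open S" unfolding S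
    by (intro open_Int open_interior open_Collect_less continuous_intros)
  have "S \<subseteq> T" using interior_subset by (auto simp: S_def T_def)
  \<comment> \<open>An interior point of the truncated cone: \<open>comb 1\<close> has level
    \<open>z\<close>, possibly negative; enough of \<open>e j\<close> is added to make the level
    positive, and scaling then brings it to 1/2.\<close>
  define z where "z = (\<Sum>k\<in>UNIV. b \<bullet> e k)"
  define u :: "real^'n" where "u = 1 + (\<bar>z\<bar> / (b \<bullet> e j) + 1) *\<^sub>R axis j 1"
  have upos: "0 < u $ k" for k
    using j by (simp add: u_def axis_def add_pos_nonneg add_nonneg_nonneg)
  have "b \<bullet> comb u = z + (\<bar>z\<bar> / (b \<bullet> e j) + 1) * (b \<bullet> e j)"
    unfolding u_def linear_add[OF linear_comb] linear_scale[OF linear_comb] comb_axis inner_add_right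
    by (simp add: inner_comb z_def)
  also have "\<dots> = z + \<bar>z\<bar> + b \<bullet> e j" using j by (simp add: field_simps)
  finally have bu: "0 < b \<bullet> comb u" using j by linarith
  define y where "y = comb ((1 / (2 * (b \<bullet> comb u))) *\<^sub>R u)"
  have "y \<in> interior K" using upos bu by (simp add: y_def comb_in_interior_K_iff)
  moreover have "b \<bullet> y = 1 / 2" using bu by (simp add: y_def linear_scale[OF linear_comb])
  ultimately have "y \<in> S" by (simp add: S_def)
  then have "interior T \<noteq> {}" using \<open>open S\<close> \<open>S \<subseteq> T\<close> interior_maximal by blast
  then have "emeasure lborel T = \<infinity>"
    by (intro emeasure_lborel_recession_direction[OF T _ w] rec)
  then have "section_volume K (hplane b) = ennreal (DIM(real^'n) * norm b) * \<infinity>"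
    using section_volume_hplane[OF b closed_K scaleR_in_K] by (simp add: T_def)
  moreover have "0 < real DIM(real^'n) * norm b" using b by simp
  ultimately show ?thesis using b by (simp add: ennreal_mult_top del: DIM_cart)
qed

text \<open>In the coordinates of \<open>comb\<close> the truncated cone is the standard simplex
  stretched by \<open>1 / (b \<bullet> e i)\<close> along axis \<open>i\<close>, which accounts for
  the product in the denominator. \<open>C\<close> is independent of \<open>b\<close>.\<close>

lemma section_volume_admissible:
  obtains C where "0 < C"
    "\<And>b. admissible b \<Longrightarrow> section_volume K (hplane b) = ennreal (C * norm b / (\<Prod>i\<in>UNIV. b \<bullet> e i))"
proof -
  obtain c where c: "0 < c"
    "\<And>S. S \<in> sets borel \<Longrightarrow> emeasure lborel (comb ` S) = ennreal c * emeasure lborel S"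
    using emeasure_lborel_linear_image[OF linear_comb inj_comb] by blast
  \<comment> \<open>The standard simplex without the origin, to match the strict inequality in
    \<open>section_volume_hplane\<close>.\<close>
  define T0 :: "(real^'n) set" where "T0 = {t. (\<forall>i. 0 \<le> t $ i) \<and> 0 < (\<Sum>i\<in>UNIV. t $ i) \<and> (\<Sum>i\<in>UNIV. t $ i) \<le> 1}"
  have T0[measurable]: "T0 \<in> sets borel" unfolding T0_def by measurable
  have "T0 \<subseteq> cbox 0 1"
  proof
    fix t assume t: "t \<in> T0"
    then have "t $ i \<le> (\<Sum>i\<in>UNIV. t $ i)" for i
      by (intro member_le_sum) (auto simp: T0_def)
    moreover have "(\<Sum>i\<in>UNIV. t $ i) \<le> 1" using t by (simp add: T0_def)
    ultimately have "t $ i \<le> 1" for i using order_trans by blast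
    with t show "t \<in> cbox 0 1" by (simp add: mem_box_cart T0_def)
  qed
  then have bdd: "bounded T0" using bounded_cbox bounded_subset by blast
  then have fin: "T0 \<in> lmeasurable" using T0 
    by (intro bounded_set_imp_lmeasurable) auto
  define S0 :: "(real^'n) set" where "S0 = (\<Inter>i. {t. 0 < t $ i}) \<inter> {t. (\<Sum>i\<in>UNIV. t $ i) < 1}"
  have "open S0" unfolding S0_def
    by (intro open_Int open_INT ballI open_Collect_less continuous_intros) auto
  moreover have "(\<chi> i. 1 / (2 * real CARD('n))) \<in> S0" by (simp add: S0_def)
  ultimately have "0 < emeasure lborel S0" by (intro emeasure_lborel_open_pos) auto
  moreover have "S0 \<subseteq> T0" by (auto simp: S0_def T0_def intro: less_imp_le sum_pos)
  ultimately have "0 < emeasure lborel T0"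
    using emeasure_mono[of S0 T0 lborel] T0 by (simp add: less_le_trans)
  then have mpos: "0 < measure lebesgue T0"
    using emeasure_eq_measure2[OF fin, symmetric] T0 by (simp flip: ennreal_less_zero_iff)
  show ?thesis
  proof (rule that[of "real CARD('n) * c * measure lebesgue T0"])
    show "0 < real CARD('n) * c * measure lebesgue T0" using c mpos by simp
    fix b assume b: "admissible b"
    let ?d = "\<lambda>t. \<chi> i. (1 / (b \<bullet> e i)) * t $ i"
    have bp: "0 < b \<bullet> e i" for i using b by (simp add: admissible_def)
    have bn: "b \<bullet> e i \<noteq> 0" for i using bp[of i] by simp
    define T where "T = {t. (\<forall>i. 0 \<le> t $ i) \<and> 0 < b \<bullet> comb t \<and> b \<bullet> comb t \<le> 1}"
    have comb_meas[measurable]: "comb \<in> borel_measurable borel"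
      using linear_comb by (auto intro!: borel_measurable_continuous_onI linear_continuous_on
          simp: linear_conv_bounded_linear)
    have T[measurable]: "T \<in> sets borel" unfolding T_def by measurable
    have "T = ?d ` T0"
    proof (intro set_eqI iffI)
      fix t assume t: "t \<in> T"
      show "t \<in> ?d ` T0"
      proof
        show "t = ?d (\<chi> i. (b \<bullet> e i) * t $ i)" using bn by (simp add: vec_eq_iff)
        show "(\<chi> i. (b \<bullet> e i) * t $ i) \<in> T0"
          using t bp by (simp add: T_def T0_def inner_comb mult.commute less_imp_le)
      qed
    next
      fix t assume "t \<in> ?d ` T0"
      then show "t \<in> T" using bp bn by (auto simp: T_def T0_def inner_comb less_imp_le)
    qed
    then have "emeasure lborel T = emeasure lebesgue (?d ` T0)" using T by simp
    also have "\<dots> = ennreal (measure lebesgue (?d ` T0))"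
      using fin by (intro emeasure_eq_measure2 measurable_stretch)
    also have "measure lebesgue (?d ` T0) = measure lebesgue T0 / (\<Prod>i\<in>UNIV. b \<bullet> e i)"
      using bp by (simp only: measure_stretch[OF fin])
        (simp add: prod_dividef abs_of_pos prod_pos)
    finally have eT: "emeasure lborel T = ennreal (measure lebesgue T0 / (\<Prod>i\<in>UNIV. b \<bullet> e i))" .
    have "{x \<in> K. 0 < b \<bullet> x \<and> b \<bullet> x \<le> 1} = comb ` T"
      by (auto simp: K_eq_comb T_def)
    then have "section_volume K (hplane b) =
        ennreal (CARD('n) * norm b) * (ennreal c * emeasure lborel T)"
      using section_volume_hplane[OF admissible_nonzero[OF b] closed_K scaleR_in_K] c(2)[OF T] by simp
    also have "\<dots> = ennreal ((CARD('n) * norm b) * (c * (measure lebesgue T0 / (\<Prod>i\<in>UNIV. b \<bullet> e i))))"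
      unfolding eT using c(1) mpos bp
      by (simp only: ennreal_mult' less_imp_le mult_nonneg_nonneg of_nat_0_le_iff norm_ge_zero)
    finally show "section_volume K (hplane b) =
        ennreal (real CARD('n) * c * measure lebesgue T0 * norm b / (\<Prod>i\<in>UNIV. b \<bullet> e i))"
      by (simp add: mult_ac)
  qed
qed

text \<open>The gradient of \<open>ln V\<close>.\<close>

definition log_grad :: "real^'n \<Rightarrow> real^'n" where
  "log_grad b = (1 / (norm b)\<^sup>2) *\<^sub>R b - (\<Sum>i\<in>UNIV. (1 / (b \<bullet> e i)) *\<^sub>R e i)"

text \<open>Euler's identity: the volume is homogeneous of degree \<open>1 - n\<close> in
  \<open>b\<close>. It determines the Lagrange multiplier.\<close>

lemma inner_log_grad:
  assumes "admissible b"
  shows "b \<bullet> log_grad b = 1 - real CARD('n)"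
proof -
  have "b \<bullet> e i \<noteq> 0" for i using assms by (metis admissible_def less_irrefl)
  then have "(\<Sum>i\<in>UNIV. (1 / (b \<bullet> e i)) * (b \<bullet> e i)) = real CARD('n)" by simp
  then show ?thesis using admissible_nonzero[OF assms]
    by (simp add: log_grad_def inner_diff_right inner_sum_right dot_square_norm)
qed

lemma gderiv_simplex_volume:
  assumes b: "admissible b"
  shows "GDERIV (\<lambda>c. C * norm c / (\<Prod>i\<in>UNIV. c \<bullet> e i)) b :>
    (C * norm b / (\<Prod>i\<in>UNIV. b \<bullet> e i)) *\<^sub>R log_grad b"
proof -
  have b0: "b \<noteq> 0" using b by (rule admissible_nonzero)
  have bp: "0 < b \<bullet> e i" for i using b by (simp add: admissible_def)
  \<comment> \<open>Logarithms turn the product into a sum that is differentiated termwise. The two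
    forms agree on the open set of admissible vectors.\<close>
  let ?q = "\<lambda>c. C * exp (ln (norm c) - (\<Sum>i\<in>UNIV. ln (c \<bullet> e i)))"
  have q: "C * norm c / (\<Prod>i\<in>UNIV. c \<bullet> e i) = ?q c" if "admissible c" for c
    using that admissible_nonzero[OF that]
    by (simp add: exp_diff exp_sum admissible_def)
  have "(?q has_derivative (\<lambda>h. h \<bullet> (?q b *\<^sub>R log_grad b))) (at b)"
  proof -
    have 1: "((\<lambda>c. ln (norm c)) has_derivative (\<lambda>h. (h \<bullet> sgn b) / norm b)) (at b)"
      using b0 by (auto intro!: derivative_eq_intros has_derivative_norm simp: field_simps)
    have 2: "((\<lambda>c. ln (c \<bullet> e i)) has_derivative (\<lambda>h. (h \<bullet> e i) / (b \<bullet> e i))) (at b)" for i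
      using bp[of i] by (auto intro!: derivative_eq_intros simp: field_simps)
    have "(?q has_derivative (\<lambda>h. C * (exp (ln (norm b) - (\<Sum>i\<in>UNIV. ln (b \<bullet> e i))) *
        ((h \<bullet> sgn b) / norm b - (\<Sum>i\<in>UNIV. (h \<bullet> e i) / (b \<bullet> e i)))))) (at b)"
      by (rule derivative_eq_intros 1 2 refl | simp add: mult.commute)+
    moreover have "h \<bullet> log_grad b = (h \<bullet> sgn b) / norm b - (\<Sum>i\<in>UNIV. (h \<bullet> e i) / (b \<bullet> e i))" for h
      by (simp add: log_grad_def inner_diff_right inner_sum_right sgn_div_norm power2_eq_square
          divide_inverse mult_ac)
    ultimately show ?thesis by (simp add: mult.assoc)
  qed
  then have "((\<lambda>c. C * norm c / (\<Prod>i\<in>UNIV. c \<bullet> e i)) has_derivative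
      (\<lambda>h. h \<bullet> (?q b *\<^sub>R log_grad b))) (at b)"
    by (rule has_derivative_transform_within_open[OF _ open_admissible]) (use b in \<open>auto simp: q\<close>)
  then show ?thesis unfolding gderiv_def q[OF b] .
qed

lemma simplex_volume_pos:
  assumes "0 < C" "admissible b"
  shows "0 < C * norm b / (\<Prod>i\<in>UNIV. b \<bullet> e i)"
  using assms admissible_nonzero[OF assms(2)]
  by (auto simp: admissible_def intro!: divide_pos_pos prod_pos)

lemma gderiv_section_volume:
  assumes C: "0 < C"
    "\<And>b. admissible b \<Longrightarrow> section_volume K (hplane b) = ennreal (C * norm b / (\<Prod>i\<in>UNIV. b \<bullet> e i))"
    and b: "admissible b"
  shows "GDERIV (\<lambda>c. enn2real (section_volume K (hplane c))) b :>
    (C * norm b / (\<Prod>i\<in>UNIV. b \<bullet> e i)) *\<^sub>R log_grad b"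
  using gderiv_simplex_volume[OF b, of C] unfolding gderiv_def
proof (rule has_derivative_transform_within_open[OF _ open_admissible])
  fix c assume "c \<in> {b. admissible b}"
  then have c: "admissible c" by simp
  then have "0 \<le> C * norm c / (\<Prod>i\<in>UNIV. c \<bullet> e i)"
    by (rule less_imp_le[OF simplex_volume_pos[OF C(1)]])
  then show "C * norm c / (\<Prod>i\<in>UNIV. c \<bullet> e i) = enn2real (section_volume K (hplane c))"
    using C(2)[OF c] by simp
qed (use b in simp)

section \<open>Stationary points and the interior of the cone\<close>

lemma stationary_points_iff:
  assumes n: "2 \<le> CARD('n)"
  shows "a \<in> stationary_points K \<longleftrightarrow>
    (\<exists>b. admissible b \<and> log_grad b = (1 - real CARD('n)) *\<^sub>R a)"
proof -
  obtain C where C: "0 < C"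
    "\<And>b. admissible b \<Longrightarrow> section_volume K (hplane b) = ennreal (C * norm b / (\<Prod>i\<in>UNIV. b \<bullet> e i))"
    using section_volume_admissible by blast
  let ?W = "\<lambda>b. C * norm b / (\<Prod>i\<in>UNIV. b \<bullet> e i)"
  let ?V = "\<lambda>c. enn2real (section_volume K (hplane c))"
  have "a \<in> stationary_points K \<longleftrightarrow>
    (\<exists>b. admissible b \<and> b \<bullet> a = 1 \<and> (\<exists>l. GDERIV ?V b :> l *\<^sub>R a))"
    by (auto simp: stationary_points_def stationary_hyperplane_def interior_dual_cone_K hplane_def)
  also have "\<dots> \<longleftrightarrow> (\<exists>b. admissible b \<and> log_grad b = (1 - real CARD('n)) *\<^sub>R a)"
  proof (intro ex_cong1 conj_cong refl)
    fix b assume b: "admissible b"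
    have G: "GDERIV ?V b :> ?W b *\<^sub>R log_grad b" by (rule gderiv_section_volume[OF C b])
    have W: "?W b \<noteq> 0" using simplex_volume_pos[OF C(1) b] by (rule less_imp_neq[symmetric])
    show "(b \<bullet> a = 1 \<and> (\<exists>l. GDERIV ?V b :> l *\<^sub>R a)) \<longleftrightarrow> log_grad b = (1 - real CARD('n)) *\<^sub>R a"
    proof (intro iffI conjI)
      assume "b \<bullet> a = 1 \<and> (\<exists>l. GDERIV ?V b :> l *\<^sub>R a)"
      then obtain l where l: "b \<bullet> a = 1" "GDERIV ?V b :> l *\<^sub>R a" by blast
      have eq: "?W b *\<^sub>R log_grad b = l *\<^sub>R a" using gderiv_unique[OF G l(2)] .
      \<comment> \<open>Pairing with \<open>b\<close> uses the constraint to determine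
        \<open>l\<close>. Conversely, the same pairing recovers the constraint, because
        \<open>1 - n\<close> is nonzero.\<close>
      then have "b \<bullet> (?W b *\<^sub>R log_grad b) = b \<bullet> (l *\<^sub>R a)" by (rule arg_cong)
      then have "?W b * (1 - real CARD('n)) = l"
        by (simp only: inner_scaleR_right inner_log_grad[OF b] l(1) mult_1_right)
      with eq have "?W b *\<^sub>R log_grad b = ?W b *\<^sub>R ((1 - real CARD('n)) *\<^sub>R a)"
        by (simp only: scaleR_scaleR)
      with W show "log_grad b = (1 - real CARD('n)) *\<^sub>R a" by (simp only: scaleR_cancel_left) simp
    next
      assume g: "log_grad b = (1 - real CARD('n)) *\<^sub>R a"
      have "(1 - real CARD('n)) * (b \<bullet> a) = 1 - real CARD('n)"
        using inner_log_grad[OF b] by (simp only: g inner_scaleR_right)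
      then show "b \<bullet> a = 1" using n by simp
      from G show "\<exists>l. GDERIV ?V b :> l *\<^sub>R a"
        unfolding g scaleR_scaleR by blast
    qed
  qed
  finally show ?thesis .
qed

text \<open>The maximum is positive, whereas \<open>f\<close> vanishes where some
  \<open>b \<bullet> e i\<close> is 0. A maximizer is therefore admissible, and the first-order
  condition applies there.\<close>

lemma interior_K_subset_stationary_points:
  assumes n: "2 \<le> CARD('n)"
  shows "interior K \<subseteq> stationary_points K"
proof
  fix a assume "a \<in> interior K"
  moreover obtain t where a: "a = comb t" using surj_comb by (metis surjD)
  ultimately have t: "0 < t $ i" for i by (simp add: comb_in_interior_K_iff)
  \<comment> \<open>In these coordinates the dual cone becomes the nonnegative orthant and the
    constraint set becomes the simplex \<open>Y\<close>, which is bounded since all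
    \<open>t $ i\<close> are positive.\<close>
  define D where "D b = (\<chi> i. b \<bullet> e i)" for b :: "real^'n"
  have lin_D: "linear D"
    by (rule linearI) (simp_all add: D_def vec_eq_iff inner_add_left)
  have "inj D"
  proof (subst linear_injective_0[OF lin_D], intro allI impI)
    fix x assume "D x = 0"
    then have x: "x \<bullet> e i = 0" for i by (simp add: D_def vec_eq_iff)
    obtain s where "x = comb s" using surj_comb by (metis surjD)
    then have "x \<bullet> x = 0" by (metis (no_types, lifting) inner_comb x mult_zero_right sum.neutral)
    then show "x = 0" by simp
  qed
  then obtain J where J: "linear J" "\<And>x. J (D x) = x" "\<And>x. D (J x) = x"
    using linear_injective_isomorphism[OF lin_D] by auto
  have J_e: "J y \<bullet> e i = y $ i" for y i
    using arg_cong[OF J(3)[of y], of "\<lambda>z. z $ i"] by (simp add: D_def)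
  have ba: "b \<bullet> a = (\<Sum>i\<in>UNIV. t $ i * (b \<bullet> e i))" for b by (simp add: a inner_comb)
  define Y where "Y = {y :: real^'n. (\<forall>i. 0 \<le> y $ i) \<and> (\<Sum>i\<in>UNIV. t $ i * y $ i) = 1}"
  have "Y = (\<Inter>i. {y. 0 \<le> y $ i}) \<inter> {y. (\<Sum>i\<in>UNIV. t $ i * y $ i) = 1}" by (auto simp: Y_def)
  also have "closed \<dots>"
    by (intro closed_Int closed_INT ballI closed_Collect_le closed_Collect_eq continuous_intros)
  finally have "closed Y" .
  moreover have "Y \<subseteq> cbox 0 (\<chi> i. 1 / t $ i)"
  proof
    fix y assume y: "y \<in> Y"
    have "t $ i * y $ i \<le> (\<Sum>i\<in>UNIV. t $ i * y $ i)" for i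
      using y t by (intro member_le_sum) (auto simp: Y_def less_imp_le)
    then have "y $ i \<le> 1 / t $ i" for i
      using y t[of i] by (simp add: Y_def field_simps)
    then show "y \<in> cbox 0 (\<chi> i. 1 / t $ i)" using y by (simp add: mem_box_cart Y_def)
  qed
  then have "bounded Y" using bounded_cbox bounded_subset by blast
  ultimately have "compact Y" by (simp add: compact_eq_bounded_closed)
  define P where "P = J ` Y"
  have "compact P" unfolding P_def using \<open>compact Y\<close> J(1)
    by (intro compact_continuous_image linear_continuous_on) (auto simp: linear_conv_bounded_linear)
  have P_iff: "b \<in> P \<longleftrightarrow> (\<forall>i. 0 \<le> b \<bullet> e i) \<and> b \<bullet> a = 1" for b
  proof -
    have "b \<in> P \<longleftrightarrow> D b \<in> Y" unfolding P_def using J by (metis imageE imageI)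
    then show ?thesis by (simp add: Y_def D_def ba)
  qed
  have P0: "b \<noteq> 0" if "b \<in> P" for b using that by (auto simp: P_iff)
  define f where "f b = (\<Prod>i\<in>UNIV. b \<bullet> e i) / norm b" for b
  \<comment> \<open>The barycenter of the simplex \<open>P\<close>, a point at which
    \<open>f\<close> is positive.\<close>
  define b0 where "b0 = J (\<chi> i. 1 / (real CARD('n) * t $ i))"
  have b0: "b0 \<bullet> e i = 1 / (real CARD('n) * t $ i)" for i by (simp add: b0_def J_e)
  have "t $ i * (1 / (real CARD('n) * t $ i)) = 1 / real CARD('n)" for i
    using t[of i] by simp
  then have "b0 \<bullet> a = 1" by (simp add: ba b0)
  then have "b0 \<in> P" using t by (simp add: P_iff b0 less_imp_le)
  moreover have "continuous_on P f" unfolding f_def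
    using P0 by (intro continuous_intros) auto
  ultimately obtain b where b: "b \<in> P" "\<And>c. c \<in> P \<Longrightarrow> f c \<le> f b"
    using continuous_attains_sup[OF \<open>compact P\<close>] by blast
  have "0 < f b0" unfolding f_def b0 using t P0[OF \<open>b0 \<in> P\<close>] by (auto intro!: divide_pos_pos prod_pos)
  with b(2)[OF \<open>b0 \<in> P\<close>] have "0 < f b" by simp
  then have "(\<Prod>i\<in>UNIV. b \<bullet> e i) \<noteq> 0" unfolding f_def by (metis div_0 less_irrefl)
  then have "b \<bullet> e i \<noteq> 0" for i by (metis UNIV_I finite prod_zero)
  then have adm: "admissible b"
    using b(1) by (metis P_iff admissible_def less_le)
  \<comment> \<open>The explicit factor 1 is the constant \<open>C\<close> of
    \<open>gderiv_simplex_volume\<close>.\<close>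
  define W where "W c = 1 * norm c / (\<Prod>i\<in>UNIV. c \<bullet> e i)" for c
  have Wf: "W c = 1 / f c" for c by (simp add: W_def f_def)
  have Wpos: "0 < W c" if "admissible c" for c
    unfolding W_def using that by (intro simplex_volume_pos) auto
  have "h \<bullet> log_grad b = 0" if h: "h \<bullet> a = 0" for h
  proof -
    \<comment> \<open>The line \<open>b + s *\<^sub>R h\<close> respects the constraint, so
      \<open>W\<close> restricted to it has a local minimum at 0 and its derivative
      vanishes.\<close>
    have der: "((\<lambda>s::real. W (b + s *\<^sub>R h)) has_derivative (\<lambda>s. (s *\<^sub>R h) \<bullet> (W b *\<^sub>R log_grad b))) (at 0)"
    proof (rule has_derivative_compose[of "\<lambda>s. b + s *\<^sub>R h"])
      show "((\<lambda>s. b + s *\<^sub>R h) has_derivative (\<lambda>s. s *\<^sub>R h)) (at 0)"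
        by (auto intro!: derivative_eq_intros)
      show "(W has_derivative (\<lambda>x. x \<bullet> (W b *\<^sub>R log_grad b))) (at (b + 0 *\<^sub>R h))"
        using gderiv_simplex_volume[OF adm, of 1] by (simp add: W_def[abs_def] gderiv_def)
    qed
    have "((\<lambda>s. b + s *\<^sub>R h) \<longlongrightarrow> b + 0 *\<^sub>R h) (at 0)"
      by (intro tendsto_intros)
    then have "eventually (\<lambda>s. b + s *\<^sub>R h \<in> {b. admissible b}) (at 0)"
      using adm by (intro topological_tendstoD open_admissible) auto
    then have "eventually (\<lambda>s. W (b + 0 *\<^sub>R h) \<le> W (b + s *\<^sub>R h)) (at 0)"
    proof eventually_elim
      fix s assume "b + s *\<^sub>R h \<in> {b. admissible b}"
      then have s: "admissible (b + s *\<^sub>R h)" by simp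
      have "b + s *\<^sub>R h \<in> P"
        using s b(1) h by (auto simp: P_iff admissible_def inner_add_left less_imp_le)
      then have "f (b + s *\<^sub>R h) \<le> f b" by (rule b(2))
      moreover have "0 < f (b + s *\<^sub>R h)" using Wpos[OF s] by (simp add: Wf)
      ultimately show "W (b + 0 *\<^sub>R h) \<le> W (b + s *\<^sub>R h)"
        by (simp add: Wf frac_le)
    qed
    from has_derivative_local_min[OF der this] have "h \<bullet> (W b *\<^sub>R log_grad b) = 0"
      by (metis scaleR_one)
    then show ?thesis using Wpos[OF adm] by simp
  qed
  moreover have "a \<noteq> 0" using b(1) by (auto simp: P_iff)
  ultimately obtain m where m: "log_grad b = m *\<^sub>R a"
    using parallel_if_orthogonal_complement by blast
  have "m = 1 - real CARD('n)"
    using inner_log_grad[OF adm] b(1) by (simp add: m P_iff)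
  with m adm show "a \<in> stationary_points K"
    unfolding stationary_points_iff[OF n] by blast
qed

lemma stationary_points_subset_interior_K:
  assumes n: "2 \<le> CARD('n)" and dual: "dual_cone K \<subseteq> K"
  shows "stationary_points K \<subseteq> interior K"
proof
  fix a assume "a \<in> stationary_points K"
  then obtain b where b: "admissible b" "log_grad b = (1 - real CARD('n)) *\<^sub>R a"
    unfolding stationary_points_iff[OF n] by blast
  have bp: "0 < b \<bullet> e i" for i using b(1) by (simp add: admissible_def)
  have "b \<in> interior K"
    using b(1) interior_mono[OF dual] interior_dual_cone_K by blast
  moreover obtain s where s: "b = comb s" using surj_comb by (metis surjD)
  ultimately have sp: "0 < s $ i" for i by (simp add: comb_in_interior_K_iff)
  \<comment> \<open>The coordinates of \<open>- log_grad b\<close>, that is, of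
    \<open>(n - 1) *\<^sub>R a\<close>.\<close>
  let ?q = "\<chi> i. 1 / (b \<bullet> e i) - s $ i / (norm b)\<^sup>2"
  have q: "0 < ?q $ i" for i
  proof -
    \<comment> \<open>A second index makes the remaining part of the sum for
      \<open>(norm b)\<^sup>2\<close> strictly positive.\<close>
    obtain j where j: "j \<noteq> i"
      using n by (metis UNIV_I card_le_Suc0_iff_eq finite not_less_eq_eq numeral_2_eq_2)
    have "(norm b)\<^sup>2 = (\<Sum>k\<in>UNIV. s $ k * (b \<bullet> e k))"
      using inner_comb[of b s] s by (simp add: power2_norm_eq_inner)
    also have "\<dots> = s $ i * (b \<bullet> e i) + (\<Sum>k\<in>UNIV - {i}. s $ k * (b \<bullet> e k))"
      by (simp add: sum.remove)
    finally have "(norm b)\<^sup>2 = \<dots>" .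
    moreover have "0 < (\<Sum>k\<in>UNIV - {i}. s $ k * (b \<bullet> e k))"
      using j bp sp by (intro sum_pos) auto
    ultimately have "s $ i * (b \<bullet> e i) < (norm b)\<^sup>2" by linarith
    then show ?thesis using bp[of i] admissible_nonzero[OF b(1)] by (simp add: field_simps)
  qed
  have "comb ?q = - log_grad b"
  proof -
    have "comb ?q = (\<Sum>i\<in>UNIV. (1 / (b \<bullet> e i)) *\<^sub>R e i) - (1 / (norm b)\<^sup>2) *\<^sub>R comb s"
      by (simp add: comb_def scaleR_diff_left sum_subtractf scaleR_sum_right divide_inverse mult.commute)
    then show ?thesis by (simp add: log_grad_def s[symmetric])
  qed
  then have "comb ?q = (real CARD('n) - 1) *\<^sub>R a" by (simp add: b(2) algebra_simps)
  then have "a = comb ((1 / (real CARD('n) - 1)) *\<^sub>R ?q)"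
    using n by (simp only: linear_scale[OF linear_comb]) simp
  moreover have "0 < ((1 / (real CARD('n) - 1)) *\<^sub>R ?q) $ i" for i
    using q[of i] n by (simp only: vector_scaleR_component real_scaleR_def) (intro mult_pos_pos, auto)
  ultimately show "a \<in> interior K" using comb_in_interior_K_iff by simp
qed

section \<open>A generator forming acute angles with the others\<close>

context
  fixes m :: 'n
  assumes n: "2 \<le> CARD('n)" and acute: "\<And>i. i \<noteq> m \<Longrightarrow> 0 < e m \<bullet> e i"
begin

text \<open>
  The coordinates of the point for which \<open>\<H>(e m)\<close> is stationary: the summand of \<open>log_grad (e m)\<close>
  with index \<open>m\<close> cancels against \<open>e m / (norm (e m))\<^sup>2\<close>.
\<close>

definition facet_coord :: "real^'n" where
  "facet_coord = (\<chi> i. if i = m then 0 else 1 / ((real CARD('n) - 1) * (e m \<bullet> e i)))"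

lemma admissible_e: "admissible (e m)"
  using acute e_nonzero[of m] by (metis admissible_def inner_gt_zero_iff)

lemma facet_coord_nonneg: "0 \<le> facet_coord $ i"
  using acute[of i] n by (cases "i = m") (simp_all add: facet_coord_def)

lemma facet_point_in_frontier: "comb facet_coord \<in> frontier K"
proof -
  have "comb facet_coord \<in> K" by (simp add: comb_in_K_iff facet_coord_nonneg)
  moreover have "facet_coord $ m = 0" by (simp add: facet_coord_def)
  then have "comb facet_coord \<notin> interior K" unfolding comb_in_interior_K_iff by (metis less_irrefl)
  ultimately show ?thesis by (simp add: frontier_def closed_K)
qed

lemma facet_point_stationary: "comb facet_coord \<in> stationary_points K"
proof -
  have "log_grad (e m) = - (\<Sum>i\<in>UNIV - {m}. (1 / (e m \<bullet> e i)) *\<^sub>R e i)"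
    by (simp add: log_grad_def sum.remove[of UNIV m] power2_norm_eq_inner)
  also have "(\<Sum>i\<in>UNIV - {m}. (1 / (e m \<bullet> e i)) *\<^sub>R e i) = (real CARD('n) - 1) *\<^sub>R comb facet_coord"
    using n by (simp add: comb_def sum.remove[of UNIV m] facet_coord_def scaleR_sum_right)
  finally show ?thesis using admissible_e
    unfolding stationary_points_iff[OF n] by (auto simp: algebra_simps intro!: exI[of _ "e m"])
qed

text \<open>The constraint at the facet point says that the ratios over the other generators have
  mean 1, as required for the inequality of means.\<close>

lemma inner_facet_point:
  "b \<bullet> comb facet_coord = (\<Sum>i\<in>UNIV - {m}. (b \<bullet> e i) / (e m \<bullet> e i)) / (real CARD('n) - 1)"
  by (simp add: inner_comb sum.remove[of UNIV m] facet_coord_def sum_divide_distrib mult.commute)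

lemma inner_e_facet_point: "e m \<bullet> comb facet_coord = 1"
proof -
  have "(e m \<bullet> e i) / (e m \<bullet> e i) = 1" if "i \<in> UNIV - {m}" for i using acute[of i] that by simp
  then have "(\<Sum>i\<in>UNIV - {m}. (e m \<bullet> e i) / (e m \<bullet> e i)) = real (card (UNIV - {m}))"
    by simp
  then show ?thesis using n by (simp add: inner_facet_point card_Diff_singleton of_nat_diff)
qed

lemma simplex_volume_unique_min:
  assumes C: "0 < C" and b: "admissible b" "b \<bullet> comb facet_coord = 1"
    and le: "C * norm b / (\<Prod>i\<in>UNIV. b \<bullet> e i) \<le> C * norm (e m) / (\<Prod>i\<in>UNIV. e m \<bullet> e i)"
  shows "b = e m"
proof -
  have bp: "0 < b \<bullet> e i" for i using b(1) by (simp add: admissible_def)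
  have ep: "0 < e m \<bullet> e i" for i using admissible_e by (simp add: admissible_def)
  let ?S = "UNIV - {m}"
  define p q where "p = (\<Prod>i\<in>?S. b \<bullet> e i)" and "q = (\<Prod>i\<in>?S. e m \<bullet> e i)"
  have pq: "0 < p" "0 < q" using bp ep by (auto simp: p_def q_def intro!: prod_pos)
  have sum: "(\<Sum>i\<in>?S. (b \<bullet> e i) / (e m \<bullet> e i)) = real (card ?S)"
    using b(2) n by (simp add: inner_facet_point card_Diff_singleton of_nat_diff field_simps)
  have "(\<Prod>i\<in>?S. (b \<bullet> e i) / (e m \<bullet> e i)) \<le> 1"
    using bp ep sum by (intro prod_le_1_if_sum_le_card) auto
  then have "p \<le> q" using pq by (simp add: prod_dividef p_def q_def)
  have "C * norm b / ((b \<bullet> e m) * p) \<le> C * norm (e m) / ((e m \<bullet> e m) * q)"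
    using le by (simp add: prod.remove[of UNIV m] p_def q_def)
  also have "\<dots> = C / (norm (e m) * q)"
    using e_nonzero[of m] by (simp add: dot_square_norm power2_eq_square)
  \<comment> \<open>With \<open>p \<le> q\<close> this gives the reverse of Cauchy-Schwarz, so
    \<open>b\<close> is parallel to \<open>e m\<close>.\<close>
  finally have "norm b * (norm (e m) * q) \<le> (b \<bullet> e m) * p"
    using C bp[of m] pq e_nonzero[of m] by (simp add: field_simps)
  also have "\<dots> \<le> (b \<bullet> e m) * q" using \<open>p \<le> q\<close> bp[of m] by simp
  finally have "norm b * norm (e m) \<le> b \<bullet> e m" using pq by (simp add: mult.assoc[symmetric])
  then have "b \<bullet> e m = norm b * norm (e m)" using norm_cauchy_schwarz[of b "e m"] by simp
  then have eq: "norm b *\<^sub>R e m = norm (e m) *\<^sub>R b" by (simp add: norm_cauchy_schwarz_eq)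
  \<comment> \<open>Both vectors satisfy the constraint, which fixes the scale.\<close>
  from arg_cong[OF this, of "\<lambda>x. x \<bullet> comb facet_coord"]
  have "norm b = norm (e m)" using b(2) inner_e_facet_point by simp
  with eq e_nonzero[of m] show ?thesis by simp
qed

lemma facet_point_unique_minimizing_hyperplane:
  "\<exists>!H. minimizing_hyperplane K (comb facet_coord) H"
proof -
  obtain C where C: "0 < C"
    "\<And>b. admissible b \<Longrightarrow> section_volume K (hplane b) = ennreal (C * norm b / (\<Prod>i\<in>UNIV. b \<bullet> e i))"
    using section_volume_admissible by blast
  let ?a = "comb facet_coord" and ?W = "\<lambda>b. C * norm b / (\<Prod>i\<in>UNIV. b \<bullet> e i)"
  let ?P = "\<lambda>H. is_hyperplane H \<and> ?a \<in> H \<and> 0 \<notin> H"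
  have hp: "\<exists>b. H = hplane b \<and> b \<bullet> ?a = 1" if "?P H" for H
  proof -
    from that have "is_hyperplane H" and a: "?a \<in> H" and 0: "0 \<notin> H" by auto
    then obtain c d where H: "H = {x. c \<bullet> x = d}" unfolding is_hyperplane_def by auto
    \<comment> \<open>Avoiding the origin is what permits normalizing the right-hand side to
      1.\<close>
    have "d \<noteq> 0" using 0 unfolding H by simp
    then have "H = hplane ((1 / d) *\<^sub>R c)" unfolding H hplane_def by auto
    moreover from this have "((1 / d) *\<^sub>R c) \<bullet> ?a = 1" using a unfolding hplane_def by simp
    ultimately show ?thesis by blast
  qed
  \<comment> \<open>Used twice: a hyperplane with smaller section would have to be
    \<open>hplane (e m)\<close> itself, which shows minimality, and any other minimizer coincides
    with it.\<close>
  have unique: "b = e m"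
    if b: "b \<bullet> ?a = 1" and le: "section_volume K (hplane b) \<le> section_volume K (hplane (e m))" for b
  proof -
    have fin: "section_volume K (hplane (e m)) = ennreal (?W (e m))" by (rule C(2)[OF admissible_e])
    \<comment> \<open>Since the facet point lies in \<open>K\<close>, the hyperplane meets
      \<open>K\<close>; a vector that is not admissible then has an infinite section.\<close>
    have "\<exists>j. 0 < b \<bullet> e j"
    proof (rule ccontr)
      assume "\<not> ?thesis"
      then have "b \<bullet> ?a \<le> 0"
        by (auto simp: inner_comb not_less intro!: sum_nonpos mult_nonneg_nonpos facet_coord_nonneg)
      with b show False by simp
    qed
    moreover have "section_volume K (hplane b) \<noteq> \<infinity>" using le fin by (auto simp: top_unique)
    ultimately have adm: "admissible b"
      unfolding admissible_def using section_volume_infinite by (meson not_less)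
    have "ennreal (?W b) \<le> ennreal (?W (e m))" using le by (simp only: C(2)[OF adm] fin)
    then have "?W b \<le> ?W (e m)"
      using simplex_volume_pos[OF C(1) admissible_e] by (simp add: ennreal_le_iff less_imp_le)
    then show ?thesis by (rule simplex_volume_unique_min[OF C(1) adm b])
  qed
  show ?thesis
  proof (intro ex1I[of _ "hplane (e m)"])
    have "is_hyperplane (hplane (e m))"
      unfolding is_hyperplane_def hplane_def using e_nonzero[of m] by blast
    then have P: "?P (hplane (e m))"
      using inner_e_facet_point by (simp add: hplane_def)
    have "section_volume K (hplane (e m)) \<le> section_volume K H" if H: "?P H" for H
    proof (rule ccontr)
      assume less: "\<not> ?thesis"
      obtain b where b: "H = hplane b" "b \<bullet> ?a = 1" using hp[OF H] by blast
      then have "b = e m" using less by (intro unique) auto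
      with less b show False by simp
    qed
    with P show "minimizing_hyperplane K ?a (hplane (e m))"
      by (auto simp: minimizing_hyperplane_def)
    fix H assume H: "minimizing_hyperplane K ?a H"
    then have le: "section_volume K H \<le> section_volume K (hplane (e m))" and "?P H"
      using P by (simp_all add: minimizing_hyperplane_def)
    obtain b where b: "H = hplane b" "b \<bullet> ?a = 1" using hp[OF \<open>?P H\<close>] by blast
    then have "b = e m" using le by (intro unique) auto
    with b show "H = hplane (e m)" by simp
  qed
qed

end

end

theorem proposition2:
  fixes E K :: "(real ^ 'n::finite) set"
  assumes "CARD('n) \<ge> 2"
    and "independent E" and "card E = CARD('n)"
    and "K = hyperangle E"
  shows "(dual_cone K \<subseteq> K \<longrightarrow> stationary_points K = interior K) \<and>
         ((\<exists>v\<in>E. \<forall>w\<in>E - {v}. vec_angle v w < pi / 2) \<longrightarrow>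
            (\<exists>a\<in>frontier K. \<exists>!H. minimizing_hyperplane K a H) \<and>
            interior K \<subset> stationary_points K)"
proof -
  have "finite E" using assms(2) by (rule independent_imp_finite)
  then obtain e :: "'n \<Rightarrow> real^'n" where e: "bij_betw e UNIV E"
    using finite_same_card_bij[of "UNIV :: 'n set" E] assms(3) by auto
  have E: "E = range e" "inj e" using e by (auto simp: bij_betw_def)
  interpret hyperangle_basis e K
    using E(2) assms(2,4) unfolding E(1) by (rule hyperangle_basis.intro)
  note sub = interior_K_subset_stationary_points[OF assms(1)]
  have ii: "(\<exists>a\<in>frontier K. \<exists>!H. minimizing_hyperplane K a H) \<and> interior K \<subset> stationary_points K"
    if ex: "\<exists>v\<in>E. \<forall>w\<in>E - {v}. vec_angle v w < pi / 2"
  proof -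
    from ex obtain v where v: "v \<in> E" "\<forall>w\<in>E - {v}. vec_angle v w < pi / 2" by blast
    obtain m where m: "v = e m" using v E by auto
    have acute: "0 < e m \<bullet> e i" if "i \<noteq> m" for i
    proof (rule vec_angle_less_pi_half)
      have "e i \<in> E - {v}" using that E(2) by (simp add: m E(1) inj_eq)
      then show "vec_angle (e m) (e i) < pi / 2" using v(2) m by blast
    qed
    note facts = facet_point_in_frontier[OF assms(1) acute]
      facet_point_stationary[OF assms(1) acute]
      facet_point_unique_minimizing_hyperplane[OF assms(1) acute]
    \<comment> \<open>The facet point is stationary but not interior, so the inclusion is
      strict.\<close>
    have "comb (facet_coord m) \<notin> interior K" using facts(1) by (simp add: frontier_def)
    with facts(2) sub have "interior K \<subset> stationary_points K" by blast
    with facts(1,3) show ?thesis by (intro conjI bexI)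
  qed
  have i: "stationary_points K = interior K" if "dual_cone K \<subseteq> K"
    using stationary_points_subset_interior_K[OF assms(1) that] sub by (rule subset_antisym)
  show ?thesis by (rule conjI; rule impI; (erule i | erule ii))
qed

end
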